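(* Let $\mathbf{p}(x) = x^3+a_{2}x^2+a_{1}x+a_{0} \in \mathbb{Z}[x]$ be an irreducible cubic polynomial such that $a_{2}^2-a_{1}$ is even and $a_{1}a_{2}-a_{0}$ is odd. For $X\ge 1$ let $B_{\mathbf{p}}(X)$ be the set of integers $n$ with $1 \leq n \leq X$ such that $\mathbf{p}(n)$ is a sum of two squares of integers. Then $$\#B_{\mathbf{p}}(X) \gg X^{1/3 - o(1)},$$ that is, for every $\varepsilon>0$ there are constants $C>0$ and $X_0$ (depending on $\mathbf{p}$ and $\varepsilon$) such that $\#B_{\mathbf{p}}(X)\ge C X^{1/3-\varepsilon}$ for all $X\ge X_0$. *)

theory Defs
  imports Complex_Main "HOL-Computational_Algebra.Computational_Algebra"
begin

definition sum_of_two_squares :: "int \<Rightarrow> bool" where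
  "sum_of_two_squares m \<longleftrightarrow> (\<exists>u v :: int. m = u\<^sup>2 + v\<^sup>2)"

definition B :: "int poly \<Rightarrow> real \<Rightarrow> int set" where
  "B p X = {n. 1 \<le> n \<and> real_of_int n \<le> X \<and> sum_of_two_squares (poly p n)}"

end

theory Submission
  imports Defs "HOL-Number_Theory.Totient"
begin

text \<open>
  Let \<open>\<theta>\<close> be a root of \<open>p\<close>. If \<open>x - \<theta> = \<alpha>\<^sup>2 + \<beta>\<^sup>2\<close> with \<open>\<alpha> = a + b \<theta> + c \<theta>\<^sup>2\<close> and
  \<open>\<beta> = a' + b' \<theta> + c' \<theta>\<^sup>2\<close> in \<open>\<int>[\<theta>]\<close>, then taking norms shows that \<open>p(x)\<close> is a norm from \<open>\<int>[\<i>]\<close>.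
  For given \<open>b, b', c, c'\<close>, the vanishing of the \<open>\<theta>\<^sup>2\<close> coefficient and the value \<open>-1\<close> of the \<open>\<theta>\<close>
  coefficient are two linear equations for \<open>a, a'\<close> of determinant \<open>c b' - c' b\<close>. If this determinant
  is \<open>1\<close> and \<open>b, b'\<close> are odd, the parity hypotheses make the solution integral, and \<open>x = O(T\<^sup>6)\<close> when
  the four parameters are \<open>O(T)\<close>. Coprime odd pairs \<open>(b, b')\<close> provide \<open>T\<^bsup>2 - o(1)\<^esup>\<close> such elements
  \<open>\<gamma> = \<alpha> + \<i> \<beta>\<close>.

  Each \<open>x\<close> arises only \<open>T\<^bsup>o(1)\<^esup>\<close> times. The ideal of \<open>\<int>[\<i>]\<close> generated by \<open>\<gamma>(x)\<close> and \<open>p(x)\<close>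
  determines the ideal of \<open>\<gamma>\<close> in \<open>\<int>[\<i>][\<theta>]\<close>, and there are \<open>p(x)\<^bsup>o(1)\<^esup>\<close> possibilities for it by the
  divisor bound. Two such \<open>\<gamma>\<close> with the same ideal whose conjugates agree in size up to a factor of
  \<open>2\<close> have a quotient in a fixed finite set, and there are only \<open>O((log T)\<^sup>3)\<close> size classes.
\<close>

section \<open>The divisor bound\<close>

lemma card_le_card_image_mult:
  assumes "finite S" "\<And>y. y \<in> f ` S \<Longrightarrow> card {x \<in> S. f x = y} \<le> m"
  shows "card S \<le> card (f ` S) * m"
proof -
  have "S = (\<Union>y\<in>f ` S. {x \<in> S. f x = y})" by auto
  then have "card S \<le> (\<Sum>y\<in>f ` S. card {x \<in> S. f x = y})"
    using card_UN_le[of "f ` S" "\<lambda>y. {x \<in> S. f x = y}"] assms(1) by simp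
  also have "\<dots> \<le> (\<Sum>y\<in>f ` S. m)"
    by (intro sum_mono assms(2))
  finally show ?thesis by simp
qed

definition divisor_count :: "nat \<Rightarrow> nat" where
  "divisor_count n = card {d. d dvd n}"

lemma divisor_count_mult_le:
  assumes "m > 0" "n > 0"
  shows "divisor_count (m * n) \<le> divisor_count m * divisor_count n"
proof -
  have "{d. d dvd m * n} \<subseteq> (\<lambda>(a, b). a * b) ` ({d. d dvd m} \<times> {d. d dvd n})"
    by (auto dest!: division_decomp)
  then have "card {d. d dvd m * n} \<le> card ({d. d dvd m} \<times> {d. d dvd n})"
    using assms by (intro surj_card_le) auto
  then show ?thesis
    by (simp add: divisor_count_def card_cartesian_product)
qed

lemma divisor_count_prime_power:
  assumes "prime p"
  shows "divisor_count (p ^ k) \<le> Suc k"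
proof -
  have "{d. d dvd p ^ k} = (\<lambda>i. p ^ i) ` {..k}"
    using assms by (auto simp: divides_primepow_nat)
  then show ?thesis
    using card_image_le[of "{..k}" "\<lambda>i. p ^ i"] by (simp add: divisor_count_def)
qed

text \<open>A prime power \<open>p ^ k\<close> has \<open>k + 1\<close> divisors, to be compared
  with \<open>(p ^ k) powr \<epsilon>\<close>. For \<open>p\<close> at least
  \<open>2 powr (1 / \<epsilon>)\<close> the comparison holds outright. A smaller prime costs a
  factor \<open>K\<close>, and fewer than \<open>M\<close> + 1 primes are small, whence the constant
  \<open>K ^ M\<close>.\<close>

lemma divisor_count_le_powr:
  assumes "\<epsilon> > (0::real)"
  shows "\<exists>C\<ge>1. \<forall>n>0. real (divisor_count n) \<le> C * real n powr \<epsilon>"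
proof -
  \<comment> \<open>Since \<open>K * \<epsilon>\<close> \<ge> 2, \<open>k + 1\<close> is at most
    \<open>K * (1 + k * \<epsilon> / 2)\<close>, which Bernoulli's inequality bounds
    further.\<close>
  define K where "K = max 1 (2 / \<epsilon>)"
  define M :: nat where "M = nat \<lceil>2 powr (1 / \<epsilon>)\<rceil>"
  define S where "S = (\<lambda>n. {p. prime p \<and> p dvd n \<and> p < M})"
  have K: "K \<ge> 1" "K * \<epsilon> \<ge> 2"
    using assms unfolding K_def by (auto simp: max_def field_simps)
  have finS: "finite (S n)" for n
    by (rule finite_subset[of _ "{..<M}"]) (auto simp: S_def)
  have small: "real (Suc k) \<le> K * (real p ^ k) powr \<epsilon>" if "p \<ge> 2" for p k :: nat
  proof -
    have "1 + real k * \<epsilon> / 2 \<le> (1 + \<epsilon> / 2) ^ k"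
      using Bernoulli_inequality[of "\<epsilon> / 2" k] assms by simp
    also have "\<dots> \<le> (2 powr \<epsilon>) ^ k"
    proof (rule power_mono)
      have "(1 / 2 :: real) \<le> ln 2" using exp_half_le2 ln_ge_iff[of 2 "1 / 2"] by simp
      then have "\<epsilon> / 2 \<le> \<epsilon> * ln 2" using assms by (simp add: field_simps)
      then have "1 + \<epsilon> / 2 \<le> exp (\<epsilon> * ln 2)"
        using exp_ge_add_one_self[of "\<epsilon> * ln 2"] by linarith
      then show "1 + \<epsilon> / 2 \<le> 2 powr \<epsilon>" by (simp add: powr_def)
    qed (use assms in simp)
    also have "\<dots> \<le> (real p powr \<epsilon>) ^ k"
      using that assms by (intro power_mono powr_mono2) auto
    also have "\<dots> = (real p ^ k) powr \<epsilon>"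
      using that by (simp add: powr_realpow[symmetric] powr_powr mult.commute)
    finally have "K * (1 + real k * \<epsilon> / 2) \<le> K * (real p ^ k) powr \<epsilon>"
      using K by simp
    moreover have "real (Suc k) \<le> K * (1 + real k * \<epsilon> / 2)"
    proof -
      have "real k * 2 \<le> real k * (K * \<epsilon>)" using K by (intro mult_left_mono) auto
      then show ?thesis using K by (simp add: algebra_simps)
    qed
    ultimately show ?thesis by linarith
  qed
  have large: "real (Suc k) \<le> (real p ^ k) powr \<epsilon>" if "p \<ge> M" for p k :: nat
  proof -
    have "2 powr (1 / \<epsilon>) \<le> real p" using that unfolding M_def by linarith
    then have "(2 powr (1 / \<epsilon>)) powr \<epsilon> \<le> real p powr \<epsilon>"
      using assms by (intro powr_mono2) auto
    then have 2: "2 \<le> real p powr \<epsilon>" using assms by (simp add: powr_powr)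
    have "p > 0" using 2 by (cases "p = 0") auto
    have "real (Suc k) \<le> 2 ^ k"
      by (metis Suc_leI less_exp of_nat_le_iff of_nat_numeral of_nat_power)
    also have "\<dots> \<le> (real p powr \<epsilon>) ^ k" using 2 by (intro power_mono) auto
    also have "\<dots> = (real p ^ k) powr \<epsilon>"
      using \<open>p > 0\<close> by (simp add: powr_realpow[symmetric] powr_powr mult.commute)
    finally show ?thesis .
  qed
  \<comment> \<open>Strong induction strips off the full power of one prime. The exponent
    \<open>card (S n)\<close> counts the small primes met so far.\<close>
  have bound: "real (divisor_count n) \<le> K ^ card (S n) * real n powr \<epsilon>" if "n > 0" for n
    using that
  proof (induction n rule: less_induct)
    case (less n)
    show ?case
    proof (cases "n = 1")
      case True
      then have "S n = {}" by (auto simp: S_def)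
      then show ?thesis using True by (simp add: divisor_count_def)
    next
      case False
      then obtain p where p: "prime p" "p dvd n" using prime_factor_nat by blast
      define k where "k = multiplicity p n"
      obtain m where m: "n = p ^ k * m" "\<not> p dvd m"
        using multiplicity_decompose'[of n p] less.prems p not_prime_unit unfolding k_def by blast
      have "k > 0" using p less.prems unfolding k_def
        by (simp add: prime_multiplicity_gt_zero_iff)
      have "m > 0" using m less.prems by (cases m) auto
      have p2: "p \<ge> 2" using p prime_ge_2_nat by blast
      have "m < n" using m \<open>k > 0\<close> \<open>m > 0\<close> p2
        by (metis dvd_triv_right le_neq_implies_less dvd_imp_le less.prems p(2))
      note IH = less.IH[OF this \<open>m > 0\<close>]
      have "real (divisor_count n) \<le> real (divisor_count (p ^ k)) * real (divisor_count m)"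
        using divisor_count_mult_le[of "p ^ k" m] \<open>m > 0\<close> p2 m(1)
        by (metis gr_zeroI less.prems mult_eq_0_iff of_nat_le_iff of_nat_mult)
      also have "\<dots> \<le> real (Suc k) * (K ^ card (S m) * real m powr \<epsilon>)"
        using divisor_count_prime_power[OF p(1), of k] IH K
        by (intro mult_mono) (auto simp del: of_nat_Suc)
      also have "\<dots> \<le> K ^ card (S n) * ((real p ^ k) powr \<epsilon> * real m powr \<epsilon>)"
      proof (cases "p < M")
        case True
        have "S n = insert p (S m)"
          using m p True \<open>k > 0\<close> by (auto simp: S_def prime_dvd_mult_iff prime_dvd_power_iff primes_dvd_imp_eq)
        moreover have "p \<notin> S m" using m by (auto simp: S_def)
        ultimately have c: "card (S n) = Suc (card (S m))" using finS by simp
        show ?thesis unfolding c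
          using mult_right_mono[OF small[OF p2, of k], of "K ^ card (S m) * real m powr \<epsilon>"] K
          by (simp add: mult_ac)
      next
        case False
        have "S m \<subseteq> S n" using m by (auto simp: S_def)
        then have "card (S m) \<le> card (S n)" using finS card_mono by blast
        then have "K ^ card (S m) \<le> K ^ card (S n)" using K by (simp add: power_increasing)
        then have "K ^ card (S m) * (real (Suc k) * real m powr \<epsilon>)
            \<le> K ^ card (S n) * ((real p ^ k) powr \<epsilon> * real m powr \<epsilon>)"
          using False large[of p k] K by (intro mult_mono) auto
        then show ?thesis by (simp add: mult_ac)
      qed
      also have "(real p ^ k) powr \<epsilon> * real m powr \<epsilon> = real n powr \<epsilon>"
        by (simp add: m powr_mult)
      finally show ?thesis .
    qed
  qed
  show ?thesis
  proof (intro exI[of _ "K ^ M"] conjI allI impI)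
    show "1 \<le> K ^ M" using K by simp
  next
    fix n :: nat
    assume "0 < n"
    have "card (S n) \<le> card {..<M}" by (intro card_mono) (auto simp: S_def)
    then have "K ^ card (S n) \<le> K ^ M" using K by (intro power_increasing) auto
    then have "K ^ card (S n) * real n powr \<epsilon> \<le> K ^ M * real n powr \<epsilon>"
      by (rule mult_right_mono) simp
    then show "real (divisor_count n) \<le> K ^ M * real n powr \<epsilon>"
      using bound[OF \<open>0 < n\<close>] by linarith
  qed
qed

text \<open>In Gauss's identity for the sum of \<open>totient d\<close> over the divisors of
  \<open>n\<close>, every term is at most \<open>totient n\<close>. With the divisor bound this
  makes the totient nearly linear.\<close>

lemma totient_mult_divisor_count_ge:
  assumes "n > 0"
  shows "n \<le> totient n * divisor_count n"
proof -
  have "n = (\<Sum>d | d dvd n. totient d)" by (simp add: totient_divisor_sum)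
  also have "\<dots> \<le> (\<Sum>d | d dvd n. totient n)"
    using assms by (intro sum_mono) (auto intro: totient_dvd_mono)
  finally show ?thesis by (simp add: divisor_count_def mult.commute)
qed

text \<open>Relative to a fixed root \<open>r0\<close>, a root \<open>r\<close> is determined by
  \<open>gcd k (r - r0)\<close> and by the half of the interval from 0 to \<open>k\<close> in which
  it lies.\<close>

lemma card_roots_minus_one_le:
  fixes k :: nat
  assumes "k > 0"
  shows "finite {r \<in> {0..<int k}. int k dvd r\<^sup>2 + 1}"
    "card {r \<in> {0..<int k}. int k dvd r\<^sup>2 + 1} \<le> 2 * divisor_count k"
proof -
  let ?R = "{r \<in> {0..<int k}. int k dvd r\<^sup>2 + 1}"
  show fin: "finite ?R" by (rule finite_subset[of _ "{0..<int k}"]) auto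
  show "card ?R \<le> 2 * divisor_count k"
  proof (cases "?R = {}")
    case False
    then obtain r0 where r0: "int k dvd r0\<^sup>2 + 1" by auto
    define f where "f = (\<lambda>r. (nat (gcd (int k) (r - r0)), 2 * r < int k))"
    have "inj_on f ?R"
    proof (rule linorder_inj_onI)
      fix r s
      assume rs: "r < s" and "r \<in> ?R" "s \<in> ?R"
      then have r: "0 \<le> r" "int k dvd r\<^sup>2 + 1" and s: "s < int k" "int k dvd s\<^sup>2 + 1" by auto
      show "f r \<noteq> f s"
      proof
        assume "f r = f s"
        define j where "j = gcd (int k) (r - r0)"
        have js: "gcd (int k) (s - r0) = j" and half: "2 * r < int k \<longleftrightarrow> 2 * s < int k"
          using \<open>f r = f s\<close> unfolding f_def j_def by (auto simp: eq_nat_nat_iff)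
        have "j > 0" using assms by (simp add: j_def)
        obtain l where l: "int k = j * l" using gcd_dvd1[of "int k" "r - r0"] unfolding j_def by (elim dvdE)
        \<comment> \<open>\<open>k = j * l\<close> divides \<open>(q - r0) * (q + r0)\<close>. After
          cancelling \<open>j\<close>, the cofactor \<open>m\<close> of \<open>q - r0\<close> is
          coprime to \<open>l\<close>.\<close>
        have key: "l dvd q + r0" if q: "int k dvd q\<^sup>2 + 1" "gcd (int k) (q - r0) = j" for q
        proof -
          obtain m where m: "q - r0 = j * m" using q(2) gcd_dvd2[of "int k" "q - r0"] by (auto elim: dvdE)
          have cop: "coprime l m"
          proof -
            have "j * gcd l m = j"
              using gcd_mult_distrib_int[of j l m] q(2) \<open>j > 0\<close> by (simp add: l m)
            then show ?thesis using \<open>j > 0\<close> by (simp add: coprime_iff_gcd_eq_1)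
          qed
          have "int k dvd (q\<^sup>2 + 1) - (r0\<^sup>2 + 1)" by (rule dvd_diff[OF q(1) r0])
          also have "(q\<^sup>2 + 1) - (r0\<^sup>2 + 1) = j * (m * (q + r0))"
          proof -
            have "(q\<^sup>2 + 1) - (r0\<^sup>2 + 1) = (q - r0) * (q + r0)"
              by (simp add: power2_eq_square algebra_simps)
            then show ?thesis by (simp add: m)
          qed
          finally have "l dvd m * (q + r0)" using \<open>j > 0\<close> unfolding l by simp
          then show ?thesis using cop by (simp add: coprime_dvd_mult_right_iff)
        qed
        have j1: "j dvd r - r0" unfolding j_def by (rule gcd_dvd2)
        have j2: "j dvd s - r0" unfolding js[symmetric] by (rule gcd_dvd2)
        have d1: "j dvd s - r" using dvd_diff[OF j2 j1] by simp
        have l1: "l dvd r + r0" by (rule key[OF r(2) j_def[symmetric]])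
        have l2: "l dvd s + r0" by (rule key[OF s(2) js])
        have d2: "l dvd s - r" using dvd_diff[OF l2 l1] by simp
        \<comment> \<open>A common divisor of \<open>j\<close> and \<open>l\<close> divides
          \<open>2 * r0\<close> and \<open>r0^2 + 1\<close>, hence 2. So divisibility of
          \<open>s - r\<close> by \<open>j\<close> and by \<open>l\<close> loses at most a factor 2
          against divisibility by \<open>k\<close>.\<close>
        have "gcd j l dvd 2"
        proof -
          have a: "gcd j l dvd r - r0" by (rule dvd_trans[OF gcd_dvd1 j1])
          have b: "gcd j l dvd r + r0" by (rule dvd_trans[OF gcd_dvd2 l1])
          have c: "gcd j l dvd r0\<^sup>2 + 1" using r0 unfolding l by (intro dvd_trans[OF gcd_dvd1]) (rule dvd_mult_left)
          have "gcd j l dvd 2 * r0" using dvd_diff[OF b a] by simp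
          then have "gcd j l dvd 2 * r0 * r0" by (rule dvd_mult2)
          then have "gcd j l dvd 2 * (r0\<^sup>2 + 1) - 2 * r0 * r0" by (rule dvd_diff[OF dvd_mult[OF c]])
          then show ?thesis by (simp add: power2_eq_square algebra_simps)
        qed
        moreover have "int k dvd gcd j l * (s - r)"
        proof -
          have "j * l dvd gcd (j * (s - r)) (l * (s - r))"
            using d1 d2 by (auto intro!: gcd_greatest mult_dvd_mono simp: mult.commute)
          then show ?thesis unfolding l using gcd_mult_distrib_int[of "s - r" j l] rs
            by (simp add: mult.commute)
        qed
        ultimately have "int k dvd 2 * (s - r)" using dvd_trans mult_dvd_mono[OF _ dvd_refl] by blast
        \<comment> \<open>Distinct roots with the same gcd are at least \<open>k / 2\<close> apart,
          so they cannot share a half.\<close>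
        then have "int k \<le> 2 * (s - r)" using rs by (intro zdvd_imp_le) auto
        then show False using half r s by (cases "2 * r < int k") auto
      qed
    qed auto
    moreover have "f ` ?R \<subseteq> {d. d dvd k} \<times> UNIV"
      by (auto simp: f_def nat_dvd_iff)
    ultimately have "card ?R \<le> card ({d. d dvd k} \<times> (UNIV :: bool set))"
      using assms by (intro card_inj_on_le) auto
    then show ?thesis by (simp add: divisor_count_def card_cartesian_product)
  next
    case True
    then have "card ?R = 0" by (simp only: card.empty)
    then show ?thesis by (simp only: zero_le)
  qed
qed

section \<open>Ideals of the Gaussian integers containing a given integer\<close>

text \<open>
  The triple \<open>(h, k, r)\<close> encodes the ideal of \<open>\<int>[\<i>]\<close> generated by \<open>s + \<i> t\<close> and \<open>P\<close>: it is \<open>h\<close>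
  times the ideal generated by \<open>k\<close> and \<open>r + \<i>\<close>, where \<open>r\<^sup>2 \<equiv> -1\<close> modulo \<open>k\<close>.
\<close>

definition sqrt_class :: "nat \<Rightarrow> int \<times> int \<Rightarrow> nat \<times> nat \<times> int" where
  "sqrt_class P = (\<lambda>(s, t).
     let h = gcd (gcd s t) (int P); s1 = s div h; t1 = t div h;
         k = gcd (s1\<^sup>2 + t1\<^sup>2) (int P div h)
     in (nat h, nat k, SOME r. r \<in> {0..<k} \<and> k dvd s1 - r * t1))"

text \<open>After division by \<open>h\<close>, a prime dividing both \<open>t1\<close> and
  \<open>k\<close> would divide \<open>s1\<close> and \<open>P div h\<close> as well. Hence
  \<open>t1\<close> is invertible modulo \<open>k\<close>, \<open>r\<close> is the quotient
  \<open>s1 / t1\<close>, and \<open>s1^2 + t1^2 \<equiv> 0\<close> turns into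
  \<open>r^2 \<equiv> -1\<close>.\<close>

lemma sqrt_class_props:
  assumes "P > 0" and st: "int P dvd s\<^sup>2 + t\<^sup>2"
  obtains h k r s1 t1 where "sqrt_class P (s, t) = (h, k, r)"
    "s = int h * s1" "t = int h * t1" "h dvd P" "k dvd P" "k > 0" "int P dvd int h * int h * int k"
    "r \<in> {0..<int k}" "int k dvd r\<^sup>2 + 1" "int k dvd s1 - r * t1"
proof -
  define h where "h = gcd (gcd s t) (int P)"
  define s1 where "s1 = s div h"
  define t1 where "t1 = t div h"
  define P1 where "P1 = int P div h"
  define k where "k = gcd (s1\<^sup>2 + t1\<^sup>2) P1"
  define r where "r = (SOME r. r \<in> {0..<k} \<and> k dvd s1 - r * t1)"
  have h0: "h > 0" using assms by (simp add: h_def)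
  have hs: "s = h * s1" unfolding s1_def h_def
    by (metis dvd_mult_div_cancel dvd_trans gcd_dvd1)
  have ht: "t = h * t1" unfolding t1_def h_def
    by (metis dvd_mult_div_cancel dvd_trans gcd_dvd1 gcd_dvd2)
  have hP: "int P = h * P1" unfolding P1_def h_def by simp
  have P10: "P1 > 0" using hP h0 assms(1) by (metis of_nat_0_less_iff zero_less_mult_pos)
  have "h * gcd (gcd s1 t1) P1 = h"
  proof -
    have "h * gcd (gcd s1 t1) P1 = gcd (gcd (h * s1) (h * t1)) (h * P1)"
      using gcd_mult_distrib_int[of h "gcd s1 t1" P1] gcd_mult_distrib_int[of h s1 t1] h0 by simp
    also have "\<dots> = h" using hs ht hP h_def by metis
    finally show ?thesis .
  qed
  then have prim: "gcd (gcd s1 t1) P1 = 1" using h0 by simp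
  have k0: "k > 0" using P10 by (simp add: k_def)
  have kP1: "k dvd P1" and ks: "k dvd s1\<^sup>2 + t1\<^sup>2" by (simp_all add: k_def)
  have cop: "coprime t1 k"
  proof (rule ccontr)
    assume "\<not> coprime t1 k"
    then have "\<not> is_unit (gcd t1 k)" by (simp only: is_unit_gcd not_False_eq_True)
    moreover have "gcd t1 k \<noteq> 0" using k0 by simp
    ultimately obtain q where q: "prime q" "q dvd t1" "q dvd k"
      using prime_divisor_exists[of "gcd t1 k"] by auto
    have "q dvd s1\<^sup>2 + t1\<^sup>2" using dvd_trans[OF q(3) ks] .
    moreover have "q dvd t1\<^sup>2" using q(2) by (simp add: power2_eq_square)
    ultimately have "q dvd s1\<^sup>2" by (simp add: dvd_add_left_iff)
    then have "q dvd s1" using q(1) prime_dvd_power by blast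
    then have "q dvd gcd (gcd s1 t1) P1" using q dvd_trans[OF q(3) kP1] by simp
    then show False using prim q(1) by (simp add: not_prime_unit)
  qed
  obtain v where v: "[t1 * v = 1] (mod k)" using cop cong_solve_coprime_int by blast
  have ex: "(s1 * v) mod k \<in> {0..<k} \<and> k dvd s1 - (s1 * v) mod k * t1"
  proof
    show "(s1 * v) mod k \<in> {0..<k}" using k0 by simp
    have "[(s1 * v) mod k * t1 = s1 * v * t1] (mod k)" by (intro cong_mult) auto
    also have "s1 * v * t1 = s1 * (t1 * v)" by simp
    also have "[s1 * (t1 * v) = s1 * 1] (mod k)" by (intro cong_mult v) auto
    finally show "k dvd s1 - (s1 * v) mod k * t1"
      by (simp add: cong_iff_dvd_diff dvd_diff_commute)
  qed
  then have r: "r \<in> {0..<k}" "k dvd s1 - r * t1"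
    unfolding r_def using someI_ex[of "\<lambda>r. r \<in> {0..<k} \<and> k dvd s1 - r * t1"] by blast+
  have r2: "k dvd r\<^sup>2 + 1"
  proof -
    have "k dvd (s1 - r * t1) * (s1 + r * t1)" using r(2) by (rule dvd_mult2)
    then have "k dvd s1\<^sup>2 + t1\<^sup>2 - (s1 - r * t1) * (s1 + r * t1)" using ks by (rule dvd_diff[rotated])
    also have "s1\<^sup>2 + t1\<^sup>2 - (s1 - r * t1) * (s1 + r * t1) = t1\<^sup>2 * (r\<^sup>2 + 1)"
      by (simp add: power2_eq_square algebra_simps)
    finally show ?thesis using cop
      by (subst (asm) coprime_dvd_mult_right_iff) (simp_all add: coprime_commute)
  qed
  \<comment> \<open>Cancelling one \<open>h\<close> shows that \<open>P1\<close> divides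
    \<open>h * (s1^2 + t1^2)\<close>. It also divides \<open>h * P1\<close>, hence the gcd
    \<open>h * k\<close> of the two.\<close>
  have "int P dvd h * h * k"
  proof -
    have "h * P1 dvd h * (h * (s1\<^sup>2 + t1\<^sup>2))"
      using st unfolding hP[symmetric] hs ht by (simp add: power2_eq_square algebra_simps)
    then have "P1 dvd h * (s1\<^sup>2 + t1\<^sup>2)" using h0 by simp
    then have "P1 dvd gcd (h * (s1\<^sup>2 + t1\<^sup>2)) (h * P1)" by simp
    then have "P1 dvd h * k" using gcd_mult_distrib_int[of h "s1\<^sup>2 + t1\<^sup>2" P1] h0
      by (simp add: k_def)
    then show ?thesis unfolding hP by (simp add: mult.assoc)
  qed
  moreover have "sqrt_class P (s, t) = (nat h, nat k, r)"
    unfolding sqrt_class_def Let_def h_def k_def r_def s1_def t1_def P1_def by simp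
  moreover have "k dvd int P" unfolding hP using kP1 by (rule dvd_mult)
  moreover have "h dvd int P" unfolding hP by simp
  ultimately show ?thesis
    using that[of "nat h" "nat k" r s1 t1] h0 k0 r r2 hs ht by (auto simp: nat_dvd_iff)
qed

text \<open>The two conclusions are the real and imaginary parts of: \<open>P\<close> divides
  \<open>(s + \<i> t) * (s' - \<i> t')\<close>. Modulo \<open>k\<close> they follow from
  \<open>s1 \<equiv> r t1\<close>, \<open>s2 \<equiv> r t2\<close> and
  \<open>r^2 \<equiv> -1\<close>. The factor \<open>h^2\<close> then upgrades \<open>k\<close> to
  \<open>P\<close>.\<close>

lemma sqrt_class_dvd:
  assumes "P > 0" "int P dvd s\<^sup>2 + t\<^sup>2" "int P dvd s'\<^sup>2 + t'\<^sup>2"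
    and eq: "sqrt_class P (s, t) = sqrt_class P (s', t')"
  shows "int P dvd s * s' + t * t'" "int P dvd t * s' - s * t'"
proof -
  obtain h k r s1 t1 where c: "sqrt_class P (s, t) = (h, k, r)"
    "s = int h * s1" "t = int h * t1" "int P dvd int h * int h * int k"
    "int k dvd r\<^sup>2 + 1" "int k dvd s1 - r * t1"
    using sqrt_class_props[OF assms(1,2)] by metis
  obtain s2 t2 where d: "s' = int h * s2" "t' = int h * t2" "int k dvd s2 - r * t2"
    using sqrt_class_props[OF assms(1,3)] eq c(1) by (metis prod.inject)
  have "int k dvd (s1 - r * t1) * s2 + r * t1 * (s2 - r * t2) + (r\<^sup>2 + 1) * (t1 * t2)"
    by (intro dvd_add dvd_mult2[OF c(6)] dvd_mult2[OF c(5)] dvd_mult[OF d(3)])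
  also have "\<dots> = s1 * s2 + t1 * t2" by (simp add: power2_eq_square algebra_simps)
  finally have "int h * int h * int k dvd int h * int h * (s1 * s2 + t1 * t2)" by simp
  then have "int P dvd int h * int h * (s1 * s2 + t1 * t2)" using c(4) dvd_trans by blast
  then show "int P dvd s * s' + t * t'" unfolding c(2,3) d by (simp add: algebra_simps)
  have "int k dvd t1 * (s2 - r * t2) - t2 * (s1 - r * t1)"
    by (rule dvd_diff[OF dvd_mult[OF d(3)] dvd_mult[OF c(6)]])
  also have "\<dots> = t1 * s2 - s1 * t2" by (simp add: algebra_simps)
  finally have "int h * int h * int k dvd int h * int h * (t1 * s2 - s1 * t2)" by simp
  then have "int P dvd int h * int h * (t1 * s2 - s1 * t2)" using c(4) dvd_trans by blast
  then show "int P dvd t * s' - s * t'" unfolding c(2,3) d by (simp add: algebra_simps)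
qed

text \<open>Both \<open>h\<close> and \<open>k\<close> are divisors of \<open>P\<close>, and
  \<open>r\<close> is one of at most \<open>2 * divisor_count k\<close> roots of -1 modulo
  \<open>k\<close>.\<close>

lemma card_sqrt_class_le:
  assumes "P > 0" and Z: "Z \<subseteq> {(s, t). int P dvd s\<^sup>2 + t\<^sup>2}"
  shows "finite (sqrt_class P ` Z)" "card (sqrt_class P ` Z) \<le> 2 * divisor_count P ^ 3"
proof -
  define D where "D = {d. d dvd P}"
  define R where "R = (\<lambda>k. {r \<in> {0..<int k}. int k dvd r\<^sup>2 + 1})"
  have finD: "finite D" using assms by (simp add: D_def)
  have finR: "finite (R k)" if "k \<in> D" for k
    unfolding R_def using that assms(1) by (intro card_roots_minus_one_le) (auto simp: D_def intro: Nat.gr0I)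
  have sub: "sqrt_class P ` Z \<subseteq> D \<times> (SIGMA k:D. R k)"
  proof
    fix y assume "y \<in> sqrt_class P ` Z"
    then obtain s t where st: "int P dvd s\<^sup>2 + t\<^sup>2" "y = sqrt_class P (s, t)" using Z by auto
    show "y \<in> D \<times> (SIGMA k:D. R k)"
      by (rule sqrt_class_props[OF assms(1) st(1)]) (auto simp: st(2) D_def R_def)
  qed
  have fin: "finite (D \<times> (SIGMA k:D. R k))" using finD finR by auto
  then show "finite (sqrt_class P ` Z)" using sub finite_subset by blast
  have "card (sqrt_class P ` Z) \<le> card (D \<times> (SIGMA k:D. R k))" using sub fin by (rule card_mono[rotated])
  also have "\<dots> = card D * (\<Sum>k\<in>D. card (R k))"
    using finD finR by (simp add: card_cartesian_product)
  also have "\<dots> \<le> card D * (\<Sum>k\<in>D. 2 * divisor_count P)"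
  proof (intro mult_left_mono sum_mono)
    fix k assume k: "k \<in> D"
    then have "k > 0" using assms(1) by (auto simp: D_def intro: Nat.gr0I)
    have "card (R k) \<le> 2 * divisor_count k"
      unfolding R_def using \<open>k > 0\<close> by (rule card_roots_minus_one_le)
    also have "divisor_count k \<le> divisor_count P"
      unfolding divisor_count_def using k assms(1) finD by (intro card_mono) (auto simp: D_def)
    finally show "card (R k) \<le> 2 * divisor_count P" by simp
  qed simp
  also have "\<dots> = 2 * divisor_count P ^ 3"
    by (simp add: divisor_count_def D_def power3_eq_cube)
  finally show "card (sqrt_class P ` Z) \<le> 2 * divisor_count P ^ 3" .
qed

section \<open>Quadratics over the Gaussian integers\<close>

definition gauss_ints :: "complex set" where
  "gauss_ints = {z. Re z \<in> \<int> \<and> Im z \<in> \<int>}"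

lemma gauss_ints_intros [intro, simp]:
  "of_int n \<in> gauss_ints" "0 \<in> gauss_ints" "1 \<in> gauss_ints"
  "w \<in> gauss_ints \<Longrightarrow> z \<in> gauss_ints \<Longrightarrow> w + z \<in> gauss_ints"
  "w \<in> gauss_ints \<Longrightarrow> z \<in> gauss_ints \<Longrightarrow> w - z \<in> gauss_ints"
  "w \<in> gauss_ints \<Longrightarrow> z \<in> gauss_ints \<Longrightarrow> w * z \<in> gauss_ints"
  "z \<in> gauss_ints \<Longrightarrow> - z \<in> gauss_ints"
  "z \<in> gauss_ints \<Longrightarrow> cnj z \<in> gauss_ints"
  "z \<in> gauss_ints \<Longrightarrow> z ^ k \<in> gauss_ints"
proof -
  show mult: "w * z \<in> gauss_ints" if "w \<in> gauss_ints" "z \<in> gauss_ints" for w z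
    using that by (auto simp: gauss_ints_def)
  show "z ^ k \<in> gauss_ints" if "z \<in> gauss_ints"
    by (induction k) (use that mult in \<open>auto simp: gauss_ints_def\<close>)
qed (auto simp: gauss_ints_def)

lemma gauss_intsE:
  assumes "z \<in> gauss_ints"
  obtains s t where "z = Complex (of_int s) (of_int t)"
  using assms by (auto simp: gauss_ints_def complex_eq_iff elim!: Ints_cases)

lemma finite_gauss_ints_norm_le: "finite {z \<in> gauss_ints. norm z \<le> K}"
proof (rule finite_subset)
  let ?I = "{- \<lceil>K\<rceil>..\<lceil>K\<rceil>}"
  show "{z \<in> gauss_ints. norm z \<le> K} \<subseteq> (\<lambda>(s, t). Complex (of_int s) (of_int t)) ` (?I \<times> ?I)"
  proof
    fix z assume z: "z \<in> {z \<in> gauss_ints. norm z \<le> K}"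
    then obtain s t where st: "z = Complex (of_int s) (of_int t)" by (auto elim: gauss_intsE)
    have "\<bar>real_of_int s\<bar> \<le> K" "\<bar>real_of_int t\<bar> \<le> K"
      using z abs_Re_le_cmod[of z] abs_Im_le_cmod[of z] by (auto simp: st)
    then have "s \<in> ?I" "t \<in> ?I" by (auto simp: abs_le_iff) linarith+
    then show "z \<in> (\<lambda>(s, t). Complex (of_int s) (of_int t)) ` (?I \<times> ?I)" using st by auto
  qed
qed simp

fun qeval :: "complex \<times> complex \<times> complex \<Rightarrow> complex \<Rightarrow> complex" where
  "qeval (a, b, c) z = a + b * z + c * z\<^sup>2"

text \<open>Models the automorphism that sends \<i> to -\<i> and fixes \<theta>. Only coefficients
  are conjugated, so evaluation at a nonreal point need not yield the complex conjugate of the value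
  of the original.\<close>

fun qconj :: "complex \<times> complex \<times> complex \<Rightarrow> complex \<times> complex \<times> complex" where
  "qconj (a, b, c) = (cnj a, cnj b, cnj c)"

text \<open>Elements of \<open>\<int>[\<i>][\<theta>]\<close> in the basis 1, \<theta>, \<theta>^2.
  Evaluation at the three complex roots of the cubic gives their conjugates over the Gaussian
  field.\<close>

definition gauss_quads :: "(complex \<times> complex \<times> complex) set" where
  "gauss_quads = gauss_ints \<times> gauss_ints \<times> gauss_ints"

text \<open>Newton's divided differences: the values at three distinct points determine the
  coefficients, and bounds on the values bound the coefficients.\<close>

lemma qeval_interpolation:
  fixes a b c z1 z2 z3 :: complex
  assumes "z1 \<noteq> z2" "z1 \<noteq> z3" "z2 \<noteq> z3"
  defines "f \<equiv> qeval (a, b, c)"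
  shows "c = ((f z1 - f z2) / (z1 - z2) - (f z1 - f z3) / (z1 - z3)) / (z2 - z3)"
    "b = (f z1 - f z2) / (z1 - z2) - c * (z1 + z2)"
    "a = f z1 - b * z1 - c * z1\<^sup>2"
proof -
  have d: "(f z1 - f z) / (z1 - z) = b + c * (z1 + z)" if "z1 \<noteq> z" for z
  proof -
    have "f z1 - f z = (b + c * (z1 + z)) * (z1 - z)"
      by (simp add: f_def power2_eq_square algebra_simps)
    then show ?thesis using that by simp
  qed
  have "(b + c * (z1 + z2)) - (b + c * (z1 + z3)) = c * (z2 - z3)" by (simp add: algebra_simps)
  then show "c = ((f z1 - f z2) / (z1 - z2) - (f z1 - f z3) / (z1 - z3)) / (z2 - z3)"
    using d[OF assms(1)] d[OF assms(2)] assms(3) by simp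
  show "b = (f z1 - f z2) / (z1 - z2) - c * (z1 + z2)" using d[OF assms(1)] by simp
  show "a = f z1 - b * z1 - c * z1\<^sup>2" by (simp add: f_def)
qed

text \<open>Interpolation confines each coefficient to a disc, which contains finitely many Gaussian
  integers. With \<open>K = 2\<close> this is the finite set of possible quotients.\<close>

lemma finite_gauss_quads_bounded:
  assumes "z1 \<noteq> z2" "z1 \<noteq> z3" "z2 \<noteq> z3"
  shows "finite {g \<in> gauss_quads. \<forall>z\<in>{z1, z2, z3}. norm (qeval g z) \<le> K}"
proof -
  define B where "B = (\<lambda>K. {z \<in> gauss_ints. norm z \<le> K})"
  define K3 where "K3 = ((K + K) / norm (z1 - z2) + (K + K) / norm (z1 - z3)) / norm (z2 - z3)"
  define K2 where "K2 = (K + K) / norm (z1 - z2) + K3 * norm (z1 + z2)"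
  define K1 where "K1 = K + K2 * norm z1 + K3 * norm (z1\<^sup>2)"
  have "{g \<in> gauss_quads. \<forall>z\<in>{z1, z2, z3}. norm (qeval g z) \<le> K} \<subseteq> B K1 \<times> B K2 \<times> B K3"
  proof
    fix g assume g: "g \<in> {g \<in> gauss_quads. \<forall>z\<in>{z1, z2, z3}. norm (qeval g z) \<le> K}"
    obtain a b c where abc: "g = (a, b, c)" by (cases g)
    define f where "f = qeval (a, b, c)"
    have n: "norm (f z1) \<le> K" "norm (f z2) \<le> K" "norm (f z3) \<le> K"
      using g by (auto simp: abc f_def)
    have gi: "a \<in> gauss_ints" "b \<in> gauss_ints" "c \<in> gauss_ints"
      using g by (auto simp: abc gauss_quads_def)
    note ip = qeval_interpolation[OF assms, where a = a and b = b and c = c, folded f_def]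
    have diff: "norm (x - y) \<le> k + l" if "norm x \<le> k" "norm y \<le> l" for x y :: complex and k l
      using norm_triangle_ineq4[of x y] that by linarith
    have quot: "norm ((f z1 - f z) / (z1 - z)) \<le> (K + K) / norm (z1 - z)" if "norm (f z) \<le> K" for z
      unfolding norm_divide by (intro divide_right_mono diff n that norm_ge_zero)
    have c: "norm c \<le> K3"
      unfolding K3_def by (subst ip(1), subst norm_divide) (intro divide_right_mono diff quot n norm_ge_zero)
    have b: "norm b \<le> K2"
      unfolding K2_def
      by (subst ip(2)) (intro diff quot n, simp add: norm_mult c mult_right_mono)
    have a: "norm a \<le> K1"
      unfolding K1_def
      by (subst ip(3)) (intro diff n; simp add: norm_mult b c mult_right_mono)
    show "g \<in> B K1 \<times> B K2 \<times> B K3" using a b c gi by (auto simp: abc B_def)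
  qed
  moreover have "finite (B K1 \<times> B K2 \<times> B K3)"
    unfolding B_def by (intro finite_cartesian_product finite_gauss_ints_norm_le)
  ultimately show ?thesis by (rule finite_subset)
qed

lemma qeval_eqI:
  assumes "z1 \<noteq> z2" "z1 \<noteq> z3" "z2 \<noteq> z3"
    and eq: "\<forall>z\<in>{z1, z2, z3}. qeval g z = qeval g' z"
  shows "g = g'"
proof -
  obtain a b c a' b' c' where g: "g = (a, b, c)" "g' = (a', b', c')" by (metis prod_cases3)
  note i = qeval_interpolation[OF assms(1-3), where a = a and b = b and c = c]
  note j = qeval_interpolation[OF assms(1-3), where a = a' and b = b' and c = c']
  have e: "qeval (a, b, c) z1 = qeval (a', b', c') z1" "qeval (a, b, c) z2 = qeval (a', b', c') z2"
    "qeval (a, b, c) z3 = qeval (a', b', c') z3" using eq by (auto simp: g)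
  have "c = c'" using i(1) j(1) unfolding e by simp
  moreover from this have "b = b'" using i(2) j(2) unfolding e by simp
  moreover from calculation have "a = a'" using i(3) j(3) unfolding e by simp
  ultimately show ?thesis by (simp add: g)
qed

section \<open>The complex roots of an irreducible integer cubic\<close>

lemma cubic_complex_roots:
  fixes c0 c1 c2 :: complex
  obtains z1 z2 z3 where "z1 + z2 + z3 = - c2" "z1 * z2 + z1 * z3 + z2 * z3 = c1" "z1 * z2 * z3 = - c0"
proof -
  have "\<not> constant (poly [:c0, c1, c2, 1:])" by (simp add: constant_degree)
  then obtain z1 where z1: "poly [:c0, c1, c2, 1:] z1 = 0" using fundamental_theorem_of_algebra by blast
  \<comment> \<open>This quadratic is the quotient of the cubic by its linear factor at
    \<open>z1\<close>.\<close>
  have "\<not> constant (poly [:z1\<^sup>2 + c2 * z1 + c1, z1 + c2, 1:])" by (simp add: constant_degree)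
  then obtain z2 where z2: "poly [:z1\<^sup>2 + c2 * z1 + c1, z1 + c2, 1:] z2 = 0"
    using fundamental_theorem_of_algebra by blast
  define z3 where "z3 = - c2 - z1 - z2"
  have s1: "z1 + z2 + z3 = - c2" by (simp add: z3_def)
  moreover have s2: "z1 * z2 + z1 * z3 + z2 * z3 = c1"
  proof -
    have "z1\<^sup>2 + c2 * z1 + c1 + z2 * (z1 + c2 + z2) = 0" using z2 by simp
    then show ?thesis unfolding z3_def by algebra
  qed
  moreover have "z1 * z2 * z3 = - c0"
  proof -
    have "c0 + z1 * (c1 + z1 * (c2 + z1)) = 0" using z1 by simp
    then show ?thesis using s1 s2 by algebra
  qed
  ultimately show ?thesis using that by blast
qed

locale integer_cubic =
  fixes a0 a1 a2 :: int
  assumes irred: "irreducible [:a0, a1, a2, 1:]"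
begin

abbreviation f :: "'a::comm_ring_1 \<Rightarrow> 'a" where
  "f z \<equiv> z ^ 3 + of_int a2 * z ^ 2 + of_int a1 * z + of_int a0"

lemma no_integer_root: "f (x::int) \<noteq> 0"
proof
  assume "f x = 0"
  then have "poly [:a0, a1, a2, 1:] x = 0"
    by (simp add: algebra_simps power2_eq_square power3_eq_cube)
  then obtain q where q: "[:a0, a1, a2, 1:] = [:- x, 1:] * q"
    unfolding poly_eq_0_iff_dvd by (elim dvdE)
  then have "q \<noteq> 0" by auto
  then have "degree [:a0, a1, a2, 1:] = 1 + degree q" unfolding q by (subst degree_mult_eq) auto
  then have "degree q = 2" by simp
  moreover have "is_unit [:- x, 1:] \<or> is_unit q" using irreducibleD[OF irred q] .
  ultimately show False by (auto simp: is_unit_poly_iff)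
qed

text \<open>A double root would be rational, by an explicit formula in the coefficients. Being an
  algebraic integer it would then be an integer, which irreducibility excludes.\<close>

lemma no_double_root:
  fixes z w :: complex
  assumes "2 * z + w = - of_int a2" "z\<^sup>2 + 2 * z * w = of_int a1" "z\<^sup>2 * w = - of_int a0"
  shows False
proof -
  have e: "of_int a2 = - (2 * z + w)" "of_int a1 = z\<^sup>2 + 2 * z * w" "of_int a0 = - (z\<^sup>2 * w)"
    using assms by (simp_all add: minus_equation_iff)
  have z0: "f z = 0" unfolding e by algebra
  have "z \<in> \<rat>"
  proof (cases "z = w")
    case True
    then have "z = - of_int a2 / 3" using assms(1) by (simp add: field_simps)
    then show ?thesis by simp
  next
    case False
    \<comment> \<open>The identities are \<open>9 a0 - a1 a2 = 2 z (z - w)^2\<close> and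
      \<open>a2^2 - 3 a1 = (z - w)^2\<close>. Their quotient expresses \<open>z\<close>.\<close>
    have "of_int (9 * a0 - a1 * a2) = 2 * z * of_int (a2\<^sup>2 - 3 * a1)" (is "_ = 2 * z * ?D")
      by (simp add: e) algebra
    moreover have "?D = (z - w)\<^sup>2" by (simp add: e) algebra
    ultimately have "z = of_int (9 * a0 - a1 * a2) / (2 * ?D)" using False by simp
    then show ?thesis by simp
  qed
  moreover have "algebraic_int z"
    by (rule algebraic_int.intros[of "[:of_int a0, of_int a1, of_int a2, 1:]"])
       (use z0 in \<open>auto simp: coeff_pCons algebra_simps power2_eq_square power3_eq_cube split: nat.splits\<close>)
  ultimately have "z \<in> \<int>" using rational_algebraic_int_is_int by blast
  then obtain x where "z = of_int x" by (auto elim: Ints_cases)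
  then have "of_int (f x) = (0::complex)" using z0 by simp
  then show False using no_integer_root[of x] by (simp only: of_int_eq_0_iff)
qed

lemma distinct_roots_exist:
  obtains z1 z2 z3 :: complex where
    "z1 + z2 + z3 = - of_int a2" "z1 * z2 + z1 * z3 + z2 * z3 = of_int a1" "z1 * z2 * z3 = - of_int a0"
    "z1 \<noteq> z2" "z1 \<noteq> z3" "z2 \<noteq> z3"
proof -
  obtain z1 z2 z3 :: complex where e:
    "z1 + z2 + z3 = - of_int a2" "z1 * z2 + z1 * z3 + z2 * z3 = of_int a1" "z1 * z2 * z3 = - of_int a0"
    by (rule cubic_complex_roots)
  have "z1 \<noteq> z2" using e no_double_root[of z1 z3] by (auto simp: algebra_simps power2_eq_square)
  moreover have "z1 \<noteq> z3" using e no_double_root[of z1 z2] by (auto simp: algebra_simps power2_eq_square)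
  moreover have "z2 \<noteq> z3" using e no_double_root[of z2 z1] by (auto simp: algebra_simps power2_eq_square)
  ultimately show ?thesis using that e by blast
qed

end

section \<open>Norm representations of \<open>x - \<theta>\<close>\<close>

lemma qeval_qconj_of_int: "qeval (qconj g) (of_int x) = cnj (qeval g (of_int x))"
  by (cases g) simp

lemma qeval_gauss_int: "g \<in> gauss_quads \<Longrightarrow> qeval g (of_int x) \<in> gauss_ints"
  by (cases g) (auto simp: gauss_quads_def simp flip: of_int_power)

context integer_cubic
begin

text \<open>
  For \<open>g = (a, b, c)\<close> and a root \<open>\<theta>\<close>, reducing \<open>(a + b \<theta> + c \<theta>\<^sup>2) (cnj a + cnj b \<theta> + cnj c \<theta>\<^sup>2)\<close>
  modulo the cubic gives \<open>x - \<theta>\<close>; the three equations compare the coefficients of \<open>\<theta>\<^sup>2\<close>, \<open>\<theta>\<close> and \<open>1\<close>.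
\<close>

definition represents :: "complex \<times> complex \<times> complex \<Rightarrow> int \<Rightarrow> bool" where
  "represents g x \<longleftrightarrow> (case g of (a, b, c) \<Rightarrow>
     (a * cnj c + b * cnj b + c * cnj a) - of_int a2 * (b * cnj c + c * cnj b)
       + of_int (a2\<^sup>2 - a1) * (c * cnj c) = 0 \<and>
     (a * cnj b + b * cnj a) - of_int a1 * (b * cnj c + c * cnj b)
       + of_int (a1 * a2 - a0) * (c * cnj c) = - 1 \<and>
     a * cnj a - of_int a0 * (b * cnj c + c * cnj b) + of_int (a0 * a2) * (c * cnj c) = of_int x)"

text \<open>Division with remainder by the cubic, with the quotient written out. It holds for every
  \<open>z\<close>, so it serves at the roots, where the multiple of \<open>f z\<close> vanishes,
  and at \<open>z = x\<close>, where \<open>x - z\<close> vanishes.\<close>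

lemma represents_mult_conj:
  assumes "represents (a, b, c) x"
  shows "qeval (a, b, c) z * qeval (qconj (a, b, c)) z =
    of_int x - z + f z * (c * cnj c * z + (b * cnj c + c * cnj b) - of_int a2 * (c * cnj c))"
proof -
  define A :: complex where "A = of_int a2"
  define B :: complex where "B = of_int a1"
  define C :: complex where "C = of_int a0"
  \<comment> \<open>Naming the conjugates makes them independent variables and the claim a
    polynomial identity.\<close>
  define a' b' c' where "a' = cnj a" "b' = cnj b" "c' = cnj c"
  have "(a * c' + b * b' + c * a') - A * (b * c' + c * b') + (A\<^sup>2 - B) * (c * c') = 0"
    "(a * b' + b * a') - B * (b * c' + c * b') + (B * A - C) * (c * c') = - 1"
    "a * a' - C * (b * c' + c * b') + C * A * (c * c') = of_int x"
    using assms by (simp_all add: represents_def A_def B_def C_def a'_b'_c'_def)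
  then have "(a + b * z + c * z\<^sup>2) * (a' + b' * z + c' * z\<^sup>2) =
    of_int x - z + (z ^ 3 + A * z ^ 2 + B * z + C) * (c * c' * z + (b * c' + c * b') - A * (c * c'))"
    by algebra
  then show ?thesis by (simp add: A_def B_def C_def a'_b'_c'_def)
qed

lemma represents_root:
  assumes "represents g x" "f z = 0"
  shows "qeval g z * qeval (qconj g) z = of_int x - z"
  using assms by (cases g) (simp only: represents_mult_conj, simp)

text \<open>The division identity at \<open>z = x\<close>. There the value of \<open>qconj g\<close>
  is the complex conjugate of the value of \<open>g\<close>.\<close>

lemma represents_norm_dvd:
  assumes "g \<in> gauss_quads" "represents g x"
  obtains h where "h \<in> gauss_ints"
    "qeval g (of_int x) * cnj (qeval g (of_int x)) = of_int (f x) * h"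
proof -
  obtain a b c where g: "g = (a, b, c)" by (cases g)
  let ?h = "c * cnj c * of_int x + (b * cnj c + c * cnj b) - of_int a2 * (c * cnj c)"
  have "?h \<in> gauss_ints" using assms(1) by (auto simp: g gauss_quads_def)
  moreover have "qeval g (of_int x) * cnj (qeval g (of_int x)) = of_int (f x) * ?h"
    using represents_mult_conj[of a b c x "of_int x"] assms(2)
    unfolding qeval_qconj_of_int g by simp
  ultimately show ?thesis using that by blast
qed

text \<open>The left side is the norm of \<open>a + b \<theta> + c \<theta>^2\<close> over the
  Gaussian field. As an integer polynomial in \<open>a\<close>, \<open>b\<close>, \<open>c\<close>
  it is a Gaussian integer for Gaussian coefficients and commutes with conjugation.\<close>

lemma prod_qeval_roots:
  assumes "z1 + z2 + z3 = - of_int a2" "z1 * z2 + z1 * z3 + z2 * z3 = of_int a1"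
    "z1 * z2 * z3 = - of_int a0"
  shows "qeval (a, b, c) z1 * qeval (a, b, c) z2 * qeval (a, b, c) z3 =
    a ^ 3 - a\<^sup>2 * b * of_int a2 + a\<^sup>2 * c * of_int (a2\<^sup>2 - 2 * a1) + a * b\<^sup>2 * of_int a1
    + a * b * c * of_int (3 * a0 - a1 * a2) + a * c\<^sup>2 * of_int (a1\<^sup>2 - 2 * a0 * a2)
    - b ^ 3 * of_int a0 + b\<^sup>2 * c * of_int (a0 * a2) - b * c\<^sup>2 * of_int (a0 * a1)
    + c ^ 3 * of_int (a0\<^sup>2)"
proof -
  have e: "of_int a2 = - (z1 + z2 + z3)" "of_int a1 = z1 * z2 + z1 * z3 + z2 * z3"
    "of_int a0 = - (z1 * z2 * z3)"
    using assms by simp_all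
  show ?thesis by (simp add: e) algebra
qed

lemma prod_diff_roots:
  fixes z1 z2 z3 y :: complex
  assumes "z1 + z2 + z3 = - of_int a2" "z1 * z2 + z1 * z3 + z2 * z3 = of_int a1"
    "z1 * z2 * z3 = - of_int a0"
  shows "(y - z1) * (y - z2) * (y - z3) = f y"
proof -
  have e: "of_int a2 = - (z1 + z2 + z3)" "of_int a1 = z1 * z2 + z1 * z3 + z2 * z3"
    "of_int a0 = - (z1 * z2 * z3)"
    using assms by simp_all
  show ?thesis by (simp add: e) algebra
qed

text \<open>Multiplying \<open>x - z = g(z) * (qconj g)(z)\<close> over the three roots writes
  \<open>f x\<close> as the norm \<open>N g\<close> times its complex conjugate.\<close>

lemma represents_sum_of_two_squares:
  assumes "g \<in> gauss_quads" "represents g x"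
  shows "sum_of_two_squares (f x)"
proof -
  obtain z1 z2 z3 :: complex where z:
    "z1 + z2 + z3 = - of_int a2" "z1 * z2 + z1 * z3 + z2 * z3 = of_int a1"
    "z1 * z2 * z3 = - of_int a0"
    using distinct_roots_exist by blast
  have root: "f w = 0" if "w \<in> {z1, z2, z3}" for w
    using prod_diff_roots[OF z, of w] that by auto
  obtain a b c where g: "g = (a, b, c)" by (cases g)
  define N where "N = (\<lambda>g. qeval g z1 * qeval g z2 * qeval g z3)"
  have conj: "N (qconj g) = cnj (N g)"
    unfolding g qconj.simps N_def prod_qeval_roots[OF z] by simp
  have gi: "N g \<in> gauss_ints"
    unfolding g N_def prod_qeval_roots[OF z] using assms(1)
    by (intro gauss_ints_intros) (auto simp: g gauss_quads_def)
  then obtain u v where uv: "N g = Complex (of_int u) (of_int v)" by (rule gauss_intsE)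
  have "of_int (f x) = (f (of_int x) :: complex)" by simp
  also have "\<dots> = (of_int x - z1) * (of_int x - z2) * (of_int x - z3)"
    by (rule prod_diff_roots[OF z, symmetric])
  also have "\<dots> = N g * N (qconj g)"
    using root by (simp add: represents_root[OF assms(2), symmetric] N_def)
  also have "\<dots> = of_int (u\<^sup>2 + v\<^sup>2)"
    unfolding conj uv by (simp add: complex_eq_iff power2_eq_square)
  finally show ?thesis unfolding sum_of_two_squares_def by (metis of_int_eq_iff)
qed

text \<open>
  Since \<open>\<int>[\<i>][\<theta>] / (x - \<theta>)\<close> is \<open>\<int>[\<i>] / (f x)\<close>, the second hypothesis on \<open>h\<close> says that \<open>x - \<theta>\<close>,
  which is \<open>g'\<close> times its conjugate, divides \<open>g\<close> times the conjugate of \<open>g'\<close>.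
\<close>

lemma quotient_exists:
  assumes g: "g \<in> gauss_quads" "g' \<in> gauss_quads" "represents g' x"
    and h: "h \<in> gauss_ints" "qeval g (of_int x) * cnj (qeval g' (of_int x)) = of_int (f x) * h"
  obtains d where "d \<in> gauss_quads" "\<And>z. f z = 0 \<Longrightarrow> qeval g z = qeval g' z * qeval d z"
proof -
  obtain a b c a' b' c' where abc: "g = (a, b, c)" "g' = (a', b', c')" by (metis prod_cases3)
  define k0 k1 k2 k3 k4 where k_def: "k0 = a * cnj a'" "k1 = a * cnj b' + b * cnj a'"
    "k2 = a * cnj c' + b * cnj b' + c * cnj a'" "k3 = b * cnj c' + c * cnj b'" "k4 = c * cnj c'"
  define X A1 A2 A0 where X_def: "X = complex_of_int x" "A1 = complex_of_int a1" "A2 = complex_of_int a2"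
    "A0 = complex_of_int a0"
  \<comment> \<open>Let \<open>k(z)\<close> be the polynomial with coefficients \<open>k0\<close> to
    \<open>k4\<close>. At a root, \<open>k(z) = f(X) h - (k(X) - k(z))\<close>, and both
    \<open>f(X) = f(X) - f(z)\<close> and \<open>k(X) - k(z)\<close> are multiples of
    \<open>X - z\<close>. Horner's scheme gives the quotients, and reducing \<open>z^3\<close>
    modulo the cubic yields \<open>d0\<close>, \<open>d1\<close>, \<open>d2\<close>.\<close>
  define q2 where "q2 = k2 + X * (k3 + X * k4)"
  define q1 where "q1 = k1 + X * q2"
  define d2 where "d2 = h - (k3 + X * k4) + A2 * k4"
  define d1 where "d1 = h * (X + A2) - q2 + A1 * k4"
  define d0 where "d0 = h * (X\<^sup>2 + A2 * X + A1) - q1 + A0 * k4"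
  have gi: "a \<in> gauss_ints" "b \<in> gauss_ints" "c \<in> gauss_ints"
    "a' \<in> gauss_ints" "b' \<in> gauss_ints" "c' \<in> gauss_ints"
    using g by (auto simp: abc gauss_quads_def)
  have mem: "(d0, d1, d2) \<in> gauss_quads"
    unfolding gauss_quads_def d0_def d1_def d2_def q1_def q2_def X_def k_def
    using gi h(1) by (auto intro!: gauss_ints_intros)
  have H: "k0 + k1 * X + k2 * X\<^sup>2 + k3 * X ^ 3 + k4 * X ^ 4 = (X ^ 3 + A2 * X\<^sup>2 + A1 * X + A0) * h"
  proof -
    have "k0 + k1 * X + k2 * X\<^sup>2 + k3 * X ^ 3 + k4 * X ^ 4
        = (a + b * X + c * X\<^sup>2) * (cnj a' + cnj b' * X + cnj c' * X\<^sup>2)"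
      unfolding k_def by algebra
    also have "\<dots> = qeval g (of_int x) * cnj (qeval g' (of_int x))"
      by (simp add: abc X_def)
    finally show ?thesis unfolding h(2) by (simp add: X_def)
  qed
  have "qeval g z = qeval g' z * qeval (d0, d1, d2) z" if z: "f z = 0" for z
  proof -
    have z': "z ^ 3 + A2 * z\<^sup>2 + A1 * z + A0 = 0" using z by (simp add: X_def)
    have "qeval g z * qeval (qconj g') z = k0 + k1 * z + k2 * z\<^sup>2 + k3 * z ^ 3 + k4 * z ^ 4"
      unfolding abc qeval.simps qconj.simps k_def by algebra
    also have "\<dots> = (X - z) * qeval (d0, d1, d2) z"
      unfolding qeval.simps d0_def d1_def d2_def q1_def q2_def using H z' by algebra
    also have "X - z = qeval g' z * qeval (qconj g') z"
      using represents_root[OF g(3) z] by (simp add: X_def)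
    finally have "qeval (qconj g') z * qeval g z
        = qeval (qconj g') z * (qeval g' z * qeval (d0, d1, d2) z)"
      by (simp add: mult_ac)
    \<comment> \<open>The common factor can be cancelled: if it vanished, \<open>z\<close> would
      equal \<open>x\<close>, an integer root.\<close>
    moreover have "qeval (qconj g') z \<noteq> 0"
    proof
      assume "qeval (qconj g') z = 0"
      then have "z = of_int x" using represents_root[OF g(3) z] by simp
      then have "of_int (f x) = (0::complex)" using z by simp
      then show False using no_integer_root[of x] by (simp only: of_int_eq_0_iff)
    qed
    ultimately show ?thesis by simp
  qed
  then show ?thesis using that mem by blast
qed

end

section \<open>The number of representations\<close>

context integer_cubic
begin

text \<open>\<open>F\<close> records the Gaussian ideal of \<open>g(x)\<close> together with the
  dyadic sizes of \<open>g\<close> at the three roots. The first three factors of the bound count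
  its values. Within a fibre, division by one fixed member is injective into the finite set of the
  last factor.\<close>

lemma card_representations_le:
  fixes z1 z2 z3 :: complex and x :: int and Y :: real
  assumes z: "z1 + z2 + z3 = - of_int a2" "z1 * z2 + z1 * z3 + z2 * z3 = of_int a1"
    "z1 * z2 * z3 = - of_int a0"
    and dist: "z1 \<noteq> z2" "z1 \<noteq> z3" "z2 \<noteq> z3" and Y: "Y \<ge> 1"
  defines "S \<equiv> {g \<in> gauss_quads. represents g x \<and>
      (\<forall>z\<in>{z1, z2, z3}. norm (qeval g z) \<le> Y \<and> norm (qeval (qconj g) z) \<le> Y)}"
  shows "finite S"
    "real (card S) \<le> 2 * real (divisor_count (nat \<bar>f x\<bar>)) ^ 3 * (6 * log 2 Y + 2) ^ 3 *
      real (card {d \<in> gauss_quads. \<forall>z\<in>{z1, z2, z3}. norm (qeval d z) \<le> 2})"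
proof -
  define D where "D = {d \<in> gauss_quads. \<forall>z\<in>{z1, z2, z3}. norm (qeval d z) \<le> 2}"
  define P where "P = nat \<bar>f x\<bar>"
  \<comment> \<open>The floors round nothing, since \<open>g(x)\<close> is a Gaussian integer; they
    only move its parts to type \<open>int\<close>.\<close>
  define m where "m = (\<lambda>g. (\<lfloor>Re (qeval g (of_int x))\<rfloor>, \<lfloor>Im (qeval g (of_int x))\<rfloor>))"
  define box where "box = (\<lambda>g z. \<lfloor>log 2 (norm (qeval g z))\<rfloor>)"
  define F where "F = (\<lambda>g. (sqrt_class P (m g), box g z1, box g z2, box g z3))"
  define I where "I = {\<lfloor>- 5 * log 2 Y\<rfloor>..\<lfloor>log 2 Y\<rfloor>}"
  have root: "f w = 0" if "w \<in> {z1, z2, z3}" for w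
    using prod_diff_roots[OF z, of w] that by auto
  have finD: "finite D" unfolding D_def by (rule finite_gauss_quads_bounded[OF dist])
  have "S \<subseteq> {g \<in> gauss_quads. \<forall>z\<in>{z1, z2, z3}. norm (qeval g z) \<le> Y}"
    by (auto simp: S_def)
  then show finS: "finite S"
    using finite_gauss_quads_bounded[OF dist] by (rule finite_subset)
  have P0: "P > 0" using no_integer_root[of x] by (simp add: P_def)
  have m: "qeval g (of_int x) = Complex (of_int (fst (m g))) (of_int (snd (m g)))"
    if "g \<in> gauss_quads" for g
    using qeval_gauss_int[OF that, of x] by (auto elim!: gauss_intsE simp: m_def)
  have Pdvd: "int P dvd k \<longleftrightarrow> f x dvd k" for k by (simp add: P_def)
  have cls: "m ` S \<subseteq> {(s, t). int P dvd s\<^sup>2 + t\<^sup>2}"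
  proof
    fix y assume "y \<in> m ` S"
    then obtain g where g: "g \<in> gauss_quads" "represents g x" "y = m g" by (auto simp: S_def)
    obtain s t where st: "m g = (s, t)" by (cases "m g")
    obtain h where h: "h \<in> gauss_ints"
      "qeval g (of_int x) * cnj (qeval g (of_int x)) = of_int (f x) * h"
      using represents_norm_dvd[OF g(1,2)] .
    obtain u v where uv: "h = Complex (of_int u) (of_int v)" using h(1) by (rule gauss_intsE)
    have "real_of_int (s\<^sup>2 + t\<^sup>2) = of_int (f x * u)"
      using arg_cong[OF h(2), of Re] by (simp add: m[OF g(1)] st uv power2_eq_square)
    then have "s\<^sup>2 + t\<^sup>2 = f x * u" by (simp only: of_int_eq_iff)
    then show "y \<in> {(s, t). int P dvd s\<^sup>2 + t\<^sup>2}" by (simp add: g(3) st Pdvd)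
  qed
  \<comment> \<open>The six absolute values of \<open>g\<close> and \<open>qconj g\<close> at the
    roots multiply to \<open>\<bar>f x\<bar>\<close>, which is at least 1, and the other five are at
    most \<open>Y\<close>. This explains the lower end of \<open>I\<close>.\<close>
  have low: "norm (qeval g z) * Y ^ 5 \<ge> 1" if g: "g \<in> S" and zz: "z \<in> {z1, z2, z3}" for g z
  proof -
    define u where "u = (\<lambda>z. norm (qeval g z))"
    define v where "v = (\<lambda>z. norm (qeval (qconj g) z))"
    have uv: "0 \<le> u z" "u z \<le> Y" "0 \<le> v z" "v z \<le> Y" if "z \<in> {z1, z2, z3}" for z
      using g that by (auto simp: S_def u_def v_def)
    have "1 \<le> \<bar>real_of_int (f x)\<bar>" using no_integer_root[of x]
      by (metis abs_ge_zero int_one_le_iff_zero_less of_int_abs of_int_1_le_iff zero_less_abs_iff)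
    also have "\<dots> = norm (f (of_int x) :: complex)"
      by (simp flip: of_int_power of_int_mult of_int_add)
    also have "f (of_int x) = (of_int x - z1) * (of_int x - z2) * (of_int x - z3)"
      by (rule prod_diff_roots[OF z, symmetric])
    also have "norm \<dots> = (u z1 * v z1) * (u z2 * v z2) * (u z3 * v z3)"
    proof -
      have "u w * v w = norm (of_int x - w)" if "w \<in> {z1, z2, z3}" for w
        using g represents_root[OF _ root[OF that], of g x]
        by (simp add: S_def u_def v_def flip: norm_mult)
      then show ?thesis by (simp add: norm_mult)
    qed
    finally have one: "1 \<le> (u z1 * v z1) * (u z2 * v z2) * (u z3 * v z3)" .
    have aux: "p * q1 * q2 * q3 * q4 * q5 \<le> p * Y ^ 5"
      if "0 \<le> p" "0 \<le> q1" "q1 \<le> Y" "0 \<le> q2" "q2 \<le> Y" "0 \<le> q3" "q3 \<le> Y" "0 \<le> q4" "q4 \<le> Y"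
        "0 \<le> q5" "q5 \<le> Y" for p q1 q2 q3 q4 q5 :: real
    proof -
      have "p * q1 * q2 * q3 * q4 * q5 \<le> p * Y * Y * Y * Y * Y"
        using that Y by (intro mult_mono mult_nonneg_nonneg) auto
      then show ?thesis by (simp add: eval_nat_numeral mult_ac)
    qed
    consider "z = z1" | "z = z2" | "z = z3" using zz by blast
    then have "1 \<le> u z * Y ^ 5"
    proof cases
      case 1
      then show ?thesis using one aux[of "u z1" "v z1" "u z2" "v z2" "u z3" "v z3"] uv
        by (auto simp: mult_ac)
    next
      case 2
      then show ?thesis using one aux[of "u z2" "v z2" "u z1" "v z1" "u z3" "v z3"] uv
        by (auto simp: mult_ac)
    next
      case 3
      then show ?thesis using one aux[of "u z3" "v z3" "u z1" "v z1" "u z2" "v z2"] uv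
        by (auto simp: mult_ac)
    qed
    then show ?thesis by (simp add: u_def)
  qed
  have pos: "norm (qeval g z) > 0" if "g \<in> S" "z \<in> {z1, z2, z3}" for g z
    using low[OF that] by (smt (verit) mult_eq_0_iff norm_ge_zero)
  have boxI: "box g z \<in> I" if "g \<in> S" "z \<in> {z1, z2, z3}" for g z
  proof -
    have le: "norm (qeval g z) \<le> Y" using that by (auto simp: S_def)
    have "0 \<le> log 2 (norm (qeval g z) * Y ^ 5)"
      using low[OF that] by simp
    also have "\<dots> = log 2 (norm (qeval g z)) + 5 * log 2 Y"
      using pos[OF that] Y by (simp add: log_mult log_nat_power)
    finally have "- 5 * log 2 Y \<le> log 2 (norm (qeval g z))" by simp
    moreover have "log 2 (norm (qeval g z)) \<le> log 2 Y"
      using le pos[OF that] Y by (subst log_le_cancel_iff) auto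
    ultimately show ?thesis unfolding I_def box_def by (auto intro: floor_mono)
  qed
  have cardI: "real (card I) \<le> 6 * log 2 Y + 2"
  proof -
    have l: "log 2 Y \<ge> 0" using Y by simp
    have "real (card I) = of_int (\<lfloor>log 2 Y\<rfloor> - \<lfloor>- 5 * log 2 Y\<rfloor> + 1)"
    proof -
      have "\<lfloor>- 5 * log 2 Y\<rfloor> \<le> \<lfloor>log 2 Y\<rfloor>" using l by (intro floor_mono) auto
      then show ?thesis unfolding I_def by simp
    qed
    then show ?thesis by linarith
  qed
  have finI: "finite I" by (simp add: I_def)
  have "F ` S \<subseteq> (sqrt_class P ` m ` S) \<times> (I \<times> I \<times> I)"
    using boxI by (auto simp: F_def)
  then have "card (F ` S) \<le> card ((sqrt_class P ` m ` S) \<times> (I \<times> I \<times> I))"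
    using finS finI by (intro card_mono) auto
  also have "\<dots> = card (sqrt_class P ` m ` S) * card I ^ 3"
    by (simp add: card_cartesian_product power3_eq_cube)
  also have "\<dots> \<le> 2 * divisor_count P ^ 3 * card I ^ 3"
    using card_sqrt_class_le(2)[OF P0 cls] by (rule mult_right_mono) simp
  finally have cardF: "card (F ` S) \<le> 2 * divisor_count P ^ 3 * card I ^ 3" .
  have fiber: "card {g \<in> S. F g = y} \<le> card D" if "y \<in> F ` S" for y
  proof -
    from that obtain g' where "y = F g'" and "g' \<in> S" by (rule imageE)
    then have g': "g' \<in> S" "F g' = y" by simp_all
    have ex: "\<exists>d\<in>D. \<forall>z\<in>{z1, z2, z3}. qeval g z = qeval g' z * qeval d z"
      if g: "g \<in> S" "F g = y" for g
    proof -
      have gq: "g \<in> gauss_quads" "g' \<in> gauss_quads" "represents g' x"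
        using g g' by (auto simp: S_def)
      obtain s t s' t' where st: "m g = (s, t)" "m g' = (s', t')" by (metis prod.exhaust)
      have "sqrt_class P (s, t) = sqrt_class P (s', t')"
        using g(2) g'(2) st by (auto simp: F_def)
      moreover have "int P dvd s\<^sup>2 + t\<^sup>2" "int P dvd s'\<^sup>2 + t'\<^sup>2"
        using cls g(1) g'(1) st by force+
      ultimately have "f x dvd s * s' + t * t'" "f x dvd t * s' - s * t'"
        using sqrt_class_dvd[OF P0] unfolding Pdvd by blast+
      then obtain u v where uv: "s * s' + t * t' = f x * u" "t * s' - s * t' = f x * v"
        by (metis dvdE)
      have "qeval g (of_int x) * cnj (qeval g' (of_int x))
          = Complex (of_int (s * s' + t * t')) (of_int (t * s' - s * t'))"
        using gq by (simp add: m st complex_eq_iff)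
      also have "\<dots> = of_int (f x) * Complex (of_int u) (of_int v)"
        unfolding uv by (simp only: complex_eq_iff of_int_mult) simp
      finally have "qeval g (of_int x) * cnj (qeval g' (of_int x))
          = of_int (f x) * Complex (of_int u) (of_int v)" .
      moreover have "Complex (of_int u) (of_int v) \<in> gauss_ints" by (simp add: gauss_ints_def)
      ultimately obtain d where d: "d \<in> gauss_quads"
        "\<And>z. f z = 0 \<Longrightarrow> qeval g z = qeval g' z * qeval d z"
        using quotient_exists[OF gq] by blast
      have "norm (qeval d z) \<le> 2" if zz: "z \<in> {z1, z2, z3}" for z
      proof -
        \<comment> \<open>Logarithms with equal floor differ by less than 1, so the sizes agree up
          to a factor 2.\<close>
        have "box g z = box g' z" using g(2) g'(2) zz by (auto simp: F_def)
        then have "log 2 (norm (qeval g z)) \<le> 1 + log 2 (norm (qeval g' z))"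
          unfolding box_def by linarith
        also have "\<dots> = log 2 (2 * norm (qeval g' z))"
          using pos[OF g'(1) zz] by (simp add: log_mult)
        finally have "norm (qeval g z) \<le> 2 * norm (qeval g' z)"
          using pos[OF g(1) zz] pos[OF g'(1) zz] by simp
        then have "norm (qeval g' z) * norm (qeval d z) \<le> norm (qeval g' z) * 2"
          using d(2)[OF root[OF zz]] by (simp add: norm_mult)
        then show ?thesis using pos[OF g'(1) zz] by simp
      qed
      then show ?thesis using d root by (intro bexI[of _ d]) (simp_all add: D_def)
    qed
    then obtain \<delta> where \<delta>: "\<And>g. g \<in> S \<Longrightarrow> F g = y \<Longrightarrow>
        \<delta> g \<in> D \<and> (\<forall>z\<in>{z1, z2, z3}. qeval g z = qeval g' z * qeval (\<delta> g) z)"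
      by metis
    have "inj_on \<delta> {g \<in> S. F g = y}"
    proof (rule inj_onI)
      fix g1 g2 assume g12: "g1 \<in> {g \<in> S. F g = y}" "g2 \<in> {g \<in> S. F g = y}" "\<delta> g1 = \<delta> g2"
      then have "\<forall>z\<in>{z1, z2, z3}. qeval g1 z = qeval g2 z" using \<delta>[of g1] \<delta>[of g2] by simp
      then show "g1 = g2" by (rule qeval_eqI[OF dist])
    qed
    then show ?thesis using \<delta> finD by (intro card_inj_on_le[of \<delta>]) blast+
  qed
  have "card S \<le> card (F ` S) * card D"
    using finS fiber by (rule card_le_card_image_mult)
  also have "\<dots> \<le> 2 * divisor_count P ^ 3 * card I ^ 3 * card D"
    using cardF by (rule mult_right_mono) simp
  finally have "real (card S) \<le> real (2 * divisor_count P ^ 3 * card I ^ 3 * card D)"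
    by (rule of_nat_mono)
  also have "\<dots> = 2 * real (divisor_count P) ^ 3 * real (card I) ^ 3 * real (card D)" by simp
  also have "\<dots> \<le> 2 * real (divisor_count P) ^ 3 * (6 * log 2 Y + 2) ^ 3 * real (card D)"
    using cardI by (intro mult_right_mono mult_left_mono power_mono) auto
  finally show "real (card S) \<le> 2 * real (divisor_count (nat \<bar>f x\<bar>)) ^ 3 * (6 * log 2 Y + 2) ^ 3 *
      real (card {d \<in> gauss_quads. \<forall>z\<in>{z1, z2, z3}. norm (qeval d z) \<le> 2})"
    by (simp add: P_def D_def)
qed

end

section \<open>A two-parameter family of representations\<close>

text \<open>Take \<open>c\<close> as the inverse of \<open>b'\<close> modulo \<open>b\<close>,
  reduced to be nonnegative and less than \<open>b\<close>. Then \<open>c' = (c b' - 1) / b\<close>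
  is small as well.\<close>

lemma coprime_bezout_small:
  fixes b b' M :: int
  assumes "coprime b b'" "1 \<le> b" "b \<le> M" "1 \<le> b'" "b' \<le> M"
  obtains c c' where "c * b' - c' * b = 1" "\<bar>c\<bar> \<le> M" "\<bar>c'\<bar> \<le> M"
proof -
  obtain v where v: "[b' * v = 1] (mod b)"
    using assms(1) cong_solve_coprime_int[of b' b] by (auto simp: coprime_commute)
  define c where "c = v mod b"
  have c: "0 \<le> c" "c < b" using assms by (auto simp: c_def)
  have "[c * b' = v * b'] (mod b)" unfolding c_def by (intro cong_mult) auto
  then have "[c * b' = 1] (mod b)" using v by (metis cong_trans mult.commute)
  then obtain c' where c': "c * b' - 1 = b * c'" by (auto simp: cong_iff_dvd_diff)
  have "c' < b'"
  proof -
    have "b * c' < b * b'" using c' c mult_strict_right_mono[of c b b'] assms by linarith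
    then show ?thesis using assms by simp
  qed
  \<comment> \<open>The value -1 can occur only for \<open>c = 0\<close>, which forces
    \<open>b = 1\<close>.\<close>
  moreover have "- 1 \<le> c'"
  proof (rule ccontr)
    assume "\<not> - 1 \<le> c'"
    then have "b * c' \<le> b * (- 2)" using assms by (intro mult_left_mono) auto
    moreover have "0 \<le> c * b'" using c assms by simp
    ultimately show False using c' assms by linarith
  qed
  ultimately show ?thesis using that[of c c'] c c' assms by (simp add: mult.commute)
qed

context integer_cubic
begin

text \<open>A common majorant for all coefficient sums in the estimates below. The summand 3 also
  allows \<open>2 * size_const\<close> \<le> \<open>size_const^2\<close>.\<close>

definition size_const :: int where
  "size_const = 3 + 2 * \<bar>a0\<bar> + 2 * \<bar>a1\<bar> + 2 * \<bar>a2\<bar> + \<bar>a2\<^sup>2 - a1\<bar> + \<bar>a1 * a2 - a0\<bar> + \<bar>a0 * a2\<bar>"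

lemma represents_of_ints:
  fixes a a' b b' c c' :: int
  assumes "2 * (a * c + a' * c') + (b\<^sup>2 + b'\<^sup>2) - 2 * a2 * (b * c + b' * c') + (a2\<^sup>2 - a1) * (c\<^sup>2 + c'\<^sup>2) = 0"
    and "2 * (a * b + a' * b') - 2 * a1 * (b * c + b' * c') + (a1 * a2 - a0) * (c\<^sup>2 + c'\<^sup>2) = - 1"
    and "a\<^sup>2 + a'\<^sup>2 - 2 * a0 * (b * c + b' * c') + a0 * a2 * (c\<^sup>2 + c'\<^sup>2) = x"
  shows "represents (Complex (of_int a) (of_int a'), Complex (of_int b) (of_int b'),
    Complex (of_int c) (of_int c')) x"
proof -
  note casts = assms[THEN arg_cong[of _ _ real_of_int]]
  show ?thesis
    unfolding represents_def prod.case complex_eq_iff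
    using casts by (simp add: power2_eq_square algebra_simps)
qed

text \<open>In terms of \<open>r = a c + a' c'\<close> and \<open>s = a b + a' b'\<close>, the first
  two equations prescribe \<open>2 r\<close> and \<open>2 s\<close>. The parity hypotheses make both
  prescribed values even, and the determinant 1 makes \<open>a\<close>, \<open>a'\<close> integers.
  The third equation defines \<open>x\<close>.\<close>

lemma family_member:
  fixes b b' M :: int
  assumes par: "even (a2\<^sup>2 - a1)" "odd (a1 * a2 - a0)"
    and cop: "coprime b b'" and odd: "odd b" "odd b'"
    and bnd: "1 \<le> b" "b \<le> M" "1 \<le> b'" "b' \<le> M"
  obtains a c x where "(a, Complex (of_int b) (of_int b'), c) \<in> gauss_quads"
    "represents (a, Complex (of_int b) (of_int b'), c) x"
    "norm a \<le> 4 * of_int (size_const * M ^ 3)" "norm c \<le> 2 * of_int M"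
    "\<bar>x\<bar> \<le> 9 * size_const\<^sup>2 * M ^ 6"
proof -
  let ?E = size_const
  obtain c c' where c: "c * b' - c' * b = 1" "\<bar>c\<bar> \<le> M" "\<bar>c'\<bar> \<le> M"
    using coprime_bezout_small[OF cop bnd] .
  have M1: "1 \<le> M" using bnd by linarith
  define u where "u = b\<^sup>2 + b'\<^sup>2"
  define d where "d = b * c + b' * c'"
  define w where "w = c\<^sup>2 + c'\<^sup>2"
  have mult_le: "\<bar>p * q\<bar> \<le> k * l" if "\<bar>p\<bar> \<le> k" "\<bar>q\<bar> \<le> l" for p q k l :: int
    using that by (auto simp: abs_mult intro!: mult_mono)
  have sizes: "\<bar>u\<bar> \<le> 2 * M\<^sup>2" "\<bar>d\<bar> \<le> 2 * M\<^sup>2" "\<bar>w\<bar> \<le> 2 * M\<^sup>2"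
    using mult_le[of b M b M] mult_le[of b' M b' M] mult_le[of b M c M] mult_le[of b' M c' M]
      mult_le[of c M c M] mult_le[of c' M c' M] bnd c
    unfolding u_def d_def w_def by (auto simp: power2_eq_square)
  have "even u" using odd by (simp add: u_def)
  \<comment> \<open>As \<open>b\<close> and \<open>b'\<close> are odd, the determinant has the
    parity of \<open>c + c'\<close>, and so has \<open>w\<close>.\<close>
  have "odd w"
  proof -
    have "odd (c * b' - c' * b)" using c(1) by simp
    then show ?thesis using odd by (simp add: w_def)
  qed
  have "even (- u + 2 * a2 * d - (a2\<^sup>2 - a1) * w)" using \<open>even u\<close> par by simp
  then obtain r where r: "- u + 2 * a2 * d - (a2\<^sup>2 - a1) * w = 2 * r" by (elim evenE)
  have "even (2 * a1 * d - (1 + (a1 * a2 - a0) * w))" using \<open>odd w\<close> par by simp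
  then obtain s where s: "2 * a1 * d - (1 + (a1 * a2 - a0) * w) = 2 * s" by (elim evenE)
  \<comment> \<open>Cramer's rule for the system with right sides \<open>r\<close> and
    \<open>s\<close>.\<close>
  define a where "a = b' * r - c' * s"
  define a' where "a' = c * s - b * r"
  define x where "x = a\<^sup>2 + a'\<^sup>2 - 2 * a0 * d + a0 * a2 * w"
  have r': "a * c + a' * c' = r"
  proof -
    have "a * c + a' * c' = (c * b' - c' * b) * r" by (simp add: a_def a'_def algebra_simps)
    then show ?thesis using c by simp
  qed
  have s': "a * b + a' * b' = s"
  proof -
    have "a * b + a' * b' = (c * b' - c' * b) * s" by (simp add: a_def a'_def algebra_simps)
    then show ?thesis using c by simp
  qed
  have rep: "represents (Complex (of_int a) (of_int a'), Complex (of_int b) (of_int b'),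
    Complex (of_int c) (of_int c')) x"
    by (rule represents_of_ints) (use r' s' r s in \<open>simp_all add: u_def d_def w_def x_def\<close>)
  have E1: "1 \<le> ?E" unfolding size_const_def by linarith
  have M2: "1 \<le> M\<^sup>2" using M1 by simp
  have lin: "\<bar>- p + 2 * q - y\<bar> \<le> p' + 2 * q' + y'" if "\<bar>p\<bar> \<le> p'" "\<bar>q\<bar> \<le> q'" "\<bar>y\<bar> \<le> y'"
    for p q y p' q' y' :: int
    using that by linarith
  have lin': "\<bar>2 * q - y\<bar> \<le> 2 * q' + y'" if "\<bar>q\<bar> \<le> q'" "\<bar>y\<bar> \<le> y'" for q y q' y' :: int
    using that by linarith
  have lin'': "\<bar>1 + y\<bar> \<le> 2 * m + y'" if "1 \<le> m" "\<bar>y\<bar> \<le> y'" for y y' m :: int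
    using that by linarith
  have rb: "\<bar>r\<bar> \<le> ?E * M\<^sup>2"
  proof -
    have "\<bar>2 * r\<bar> \<le> 2 * M\<^sup>2 + 2 * (\<bar>a2\<bar> * (2 * M\<^sup>2)) + \<bar>a2\<^sup>2 - a1\<bar> * (2 * M\<^sup>2)"
      unfolding r[symmetric] mult.assoc[of 2 a2 d]
      by (intro lin sizes mult_le order.refl)
    also have "\<dots> = 2 * ((1 + 2 * \<bar>a2\<bar> + \<bar>a2\<^sup>2 - a1\<bar>) * M\<^sup>2)" by (simp add: algebra_simps)
    also have "(1 + 2 * \<bar>a2\<bar> + \<bar>a2\<^sup>2 - a1\<bar>) * M\<^sup>2 \<le> ?E * M\<^sup>2"
      unfolding size_const_def by (intro mult_right_mono) auto
    finally show ?thesis by simp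
  qed
  have sb: "\<bar>s\<bar> \<le> ?E * M\<^sup>2"
  proof -
    have "\<bar>2 * s\<bar> \<le> 2 * (\<bar>a1\<bar> * (2 * M\<^sup>2)) + (2 * M\<^sup>2 + \<bar>a1 * a2 - a0\<bar> * (2 * M\<^sup>2))"
      unfolding s[symmetric] mult.assoc[of 2 a1 d]
      by (rule lin'[OF mult_le[OF order.refl sizes(2)] lin''[OF M2 mult_le[OF order.refl sizes(3)]]])
    also have "\<dots> = 2 * ((1 + 2 * \<bar>a1\<bar> + \<bar>a1 * a2 - a0\<bar>) * M\<^sup>2)" by (simp add: algebra_simps)
    also have "(1 + 2 * \<bar>a1\<bar> + \<bar>a1 * a2 - a0\<bar>) * M\<^sup>2 \<le> ?E * M\<^sup>2"
      unfolding size_const_def by (intro mult_right_mono) auto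
    finally show ?thesis by simp
  qed
  have M3: "M * (?E * M\<^sup>2) = ?E * M ^ 3" by (simp add: power2_eq_square power3_eq_cube)
  have ab: "\<bar>a\<bar> \<le> 2 * (?E * M ^ 3)" "\<bar>a'\<bar> \<le> 2 * (?E * M ^ 3)"
  proof -
    have "\<bar>b\<bar> \<le> M" "\<bar>b'\<bar> \<le> M" using bnd by auto
    note bs = mult_le[OF this(2) rb] mult_le[OF c(3) sb] mult_le[OF c(2) sb] mult_le[OF this(1) rb]
    have diff: "\<bar>p - q\<bar> \<le> 2 * k" if "\<bar>p\<bar> \<le> k" "\<bar>q\<bar> \<le> k" for p q k :: int
      using that by linarith
    show "\<bar>a\<bar> \<le> 2 * (?E * M ^ 3)" "\<bar>a'\<bar> \<le> 2 * (?E * M ^ 3)"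
      unfolding a_def a'_def M3[symmetric] by (rule diff[OF bs(1,2)] diff[OF bs(3,4)])+
  qed
  have norm_le: "norm (Complex (of_int p) (of_int q)) \<le> 2 * of_int k" if "\<bar>p\<bar> \<le> k" "\<bar>q\<bar> \<le> k" for p q k :: int
  proof -
    have "norm (Complex (of_int p) (of_int q)) \<le> \<bar>real_of_int p\<bar> + \<bar>real_of_int q\<bar>"
      using cmod_le[of "Complex (of_int p) (of_int q)"] by simp
    also have "\<dots> = of_int (\<bar>p\<bar> + \<bar>q\<bar>)" by simp
    also have "\<dots> \<le> of_int (2 * k)" using that by (intro of_int_le_iff[THEN iffD2]) linarith
    finally show ?thesis by simp
  qed
  have xb: "\<bar>x\<bar> \<le> 9 * ?E\<^sup>2 * M ^ 6"
  proof -
    have M26: "M\<^sup>2 \<le> M ^ 6" using M1 by (intro power_increasing) auto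
    have "\<bar>a * a\<bar> \<le> (2 * (?E * M ^ 3)) * (2 * (?E * M ^ 3))"
      "\<bar>a' * a'\<bar> \<le> (2 * (?E * M ^ 3)) * (2 * (?E * M ^ 3))"
      "\<bar>a0 * d\<bar> \<le> \<bar>a0\<bar> * (2 * M\<^sup>2)" "\<bar>a0 * a2 * w\<bar> \<le> \<bar>a0 * a2\<bar> * (2 * M\<^sup>2)"
      by (rule mult_le[OF ab(1) ab(1)] mult_le[OF ab(2) ab(2)] mult_le[OF order.refl sizes(2)]
          mult_le[OF order.refl sizes(3)])+
    moreover have "\<bar>p + q - 2 * y + z\<bar> \<le> p' + q' + 2 * y' + z'"
      if "\<bar>p\<bar> \<le> p'" "\<bar>q\<bar> \<le> q'" "\<bar>y\<bar> \<le> y'" "\<bar>z\<bar> \<le> z'" for p q y z p' q' y' z' :: int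
      using that by linarith
    ultimately have "\<bar>x\<bar> \<le> (2 * (?E * M ^ 3)) * (2 * (?E * M ^ 3)) + (2 * (?E * M ^ 3)) * (2 * (?E * M ^ 3))
        + 2 * (\<bar>a0\<bar> * (2 * M\<^sup>2)) + \<bar>a0 * a2\<bar> * (2 * M\<^sup>2)"
      unfolding x_def power2_eq_square[of a] power2_eq_square[of a'] mult.assoc[of 2 a0 d] by blast
    also have "\<dots> = 8 * (?E\<^sup>2 * M ^ 6) + 2 * (2 * \<bar>a0\<bar> + \<bar>a0 * a2\<bar>) * M\<^sup>2"
      by (simp add: algebra_simps power2_eq_square eval_nat_numeral)
    \<comment> \<open>The two squares account for 8 of the factor 9, and the lower-order terms fit
      into the remaining 1.\<close>
    also have "2 * (2 * \<bar>a0\<bar> + \<bar>a0 * a2\<bar>) * M\<^sup>2 \<le> ?E\<^sup>2 * M ^ 6"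
    proof (rule mult_mono[OF _ M26])
      have "2 * (2 * \<bar>a0\<bar> + \<bar>a0 * a2\<bar>) \<le> 2 * ?E" unfolding size_const_def by simp
      also have "\<dots> \<le> ?E * ?E" unfolding size_const_def by (intro mult_right_mono) auto
      finally show "2 * (2 * \<bar>a0\<bar> + \<bar>a0 * a2\<bar>) \<le> ?E\<^sup>2" by (simp add: power2_eq_square)
    qed auto
    finally show ?thesis by (simp add: mult.commute)
  qed
  show ?thesis
  proof (rule that[OF _ rep])
    show "(Complex (of_int a) (of_int a'), Complex (of_int b) (of_int b'),
      Complex (of_int c) (of_int c')) \<in> gauss_quads"
      by (simp add: gauss_quads_def gauss_ints_def)
    show "norm (Complex (of_int a) (of_int a')) \<le> 4 * of_int (?E * M ^ 3)"
      using norm_le[OF ab] by simp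
    show "norm (Complex (of_int c) (of_int c')) \<le> 2 * of_int M"
      using norm_le[OF c(2,3)] .
    show "\<bar>x\<bar> \<le> 9 * ?E\<^sup>2 * M ^ 6" by (rule xb)
  qed
qed

text \<open>\<open>f x\<close> is a sum of two squares, hence nonnegative, whereas a monic cubic is
  negative far to the left. Only boundedly many represented integers are therefore not
  positive.\<close>

lemma represents_lower_bound:
  assumes "g \<in> gauss_quads" "represents g x"
  shows "x > - (1 + \<bar>a0\<bar> + \<bar>a1\<bar> + \<bar>a2\<bar>)"
proof (rule ccontr)
  define L where "L = 1 + \<bar>a0\<bar> + \<bar>a1\<bar> + \<bar>a2\<bar>"
  define y where "y = - x"
  assume "\<not> ?thesis"
  then have y: "y \<ge> L" by (simp add: L_def y_def)
  have y1: "y \<ge> 1" using y by (simp add: L_def)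
  have "f x \<ge> 0" using represents_sum_of_two_squares[OF assms] unfolding sum_of_two_squares_def by auto
  then have "y ^ 3 \<le> a2 * y\<^sup>2 - a1 * y + a0" by (simp add: y_def)
  also have "\<dots> \<le> \<bar>a2\<bar> * y\<^sup>2 + \<bar>a1\<bar> * y\<^sup>2 + \<bar>a0\<bar> * y\<^sup>2"
  proof -
    have "a2 * y\<^sup>2 \<le> \<bar>a2\<bar> * y\<^sup>2" by (intro mult_right_mono) auto
    moreover have "- a1 * y \<le> \<bar>a1\<bar> * y\<^sup>2"
      using y1 by (intro mult_mono) (auto simp: power2_eq_square)
    moreover have "a0 * 1 \<le> \<bar>a0\<bar> * y\<^sup>2" using y1 by (intro mult_mono) auto
    ultimately show ?thesis by simp
  qed
  also have "\<dots> = (L - 1) * y\<^sup>2" by (simp add: L_def algebra_simps)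
  also have "\<dots> < L * y\<^sup>2" using y1 by (intro mult_strict_right_mono) auto
  also have "\<dots> \<le> y * y\<^sup>2" using y by (intro mult_right_mono) auto
  finally show False by (simp add: power2_eq_square power3_eq_cube)
qed

end

section \<open>Counting\<close>

text \<open>Only the first entry is required to be odd. An even second entry is made odd later by
  adding the first.\<close>

definition odd_coprime_pairs :: "nat \<Rightarrow> (nat \<times> nat) set" where
  "odd_coprime_pairs T = (SIGMA n:{n. odd n \<and> T < n \<and> n \<le> 2 * T}. totatives n)"

lemma card_odd_between_ge: "T div 2 \<le> card {n. odd n \<and> T < n \<and> n \<le> 2 * T}"
proof -
  have "card ((\<lambda>k. 2 * k + 1) ` {(T + 1) div 2..<T}) \<le> card {n. odd n \<and> T < n \<and> n \<le> 2 * T}"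
    by (intro card_mono finite_subset[of "{n. odd n \<and> T < n \<and> n \<le> 2 * T}" "{..2 * T}"]) auto
  moreover have "card ((\<lambda>k. 2 * k + 1) ` {(T + 1) div 2..<T}) = T - (T + 1) div 2"
    by (subst card_image) (auto simp: inj_on_def)
  ultimately show ?thesis by linarith
qed

text \<open>About \<open>T / 2\<close> odd \<open>n\<close> contribute \<open>totient n\<close>
  pairs each, and \<open>totient n\<close> is at least \<open>n\<close> divided by its number of
  divisors.\<close>

lemma card_odd_coprime_pairs_ge:
  assumes "e > (0::real)"
  shows "\<exists>c>0. \<forall>T\<ge>2. c * real T powr (2 - e) \<le> real (card (odd_coprime_pairs T))"
proof -
  obtain C where C: "C \<ge> 1" "\<And>n. n > 0 \<Longrightarrow> real (divisor_count n) \<le> C * real n powr e"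
    using divisor_count_le_powr[OF assms] by blast
  show ?thesis
  proof (intro exI[of _ "1 / (3 * C * 2 powr e)"] conjI allI impI)
    show "0 < 1 / (3 * C * 2 powr e)" using C by simp
  next
    fix T :: nat assume T: "2 \<le> T"
    define N where "N = {n. odd n \<and> T < n \<and> n \<le> 2 * T}"
    define L where "L = real T / (C * (2 * real T) powr e)"
    have L0: "L \<ge> 0" using C by (simp add: L_def)
    have finN: "finite N" unfolding N_def by (rule finite_subset[of _ "{..2 * T}"]) auto
    have each: "L \<le> real (card (totatives n))" if "n \<in> N" for n
    proof -
      have n: "T < n" "n \<le> 2 * T" using that by (auto simp: N_def)
      have "real T \<le> real n" using n by simp
      also have "\<dots> \<le> real (totient n) * real (divisor_count n)"
        using totient_mult_divisor_count_ge[of n] n by (simp flip: of_nat_mult)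
      also have "\<dots> \<le> real (totient n) * (C * real n powr e)"
        using C(2)[of n] n by (intro mult_left_mono) auto
      also have "\<dots> \<le> real (totient n) * (C * (2 * real T) powr e)"
        using n C assms by (intro mult_left_mono powr_mono2) auto
      finally show ?thesis using C T unfolding L_def totient_def by (subst pos_divide_le_eq) auto
    qed
    \<comment> \<open>Valid from \<open>T = 2\<close> on, with equality at
      \<open>T = 3\<close>.\<close>
    have "T \<le> 3 * (T div 2)" using T by presburger
    then have "real T / 3 \<le> real (T div 2)" by linarith
    also have "\<dots> \<le> real (card N)" using card_odd_between_ge[of T] by (simp add: N_def)
    finally have "real T / 3 * L \<le> real (card N) * L" using L0 by (rule mult_right_mono)
    also have "\<dots> = (\<Sum>n\<in>N. L)" by simp
    also have "\<dots> \<le> (\<Sum>n\<in>N. real (card (totatives n)))" by (intro sum_mono each)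
    also have "\<dots> = real (card (odd_coprime_pairs T))"
      unfolding odd_coprime_pairs_def N_def[symmetric] using finN by simp
    also have "real T / 3 * L = 1 / (3 * C * 2 powr e) * real T powr (2 - e)"
      using T C by (simp add: L_def powr_mult powr_diff power2_eq_square field_simps)
    finally show "1 / (3 * C * 2 powr e) * real T powr (2 - e) \<le> real (card (odd_coprime_pairs T))" .
  qed
qed

lemma powr_mult_power:
  assumes "0 < k" "0 < (t::real)"
  shows "(k * t ^ n) powr e = k powr e * t powr (real n * e)"
proof -
  have "t ^ n = t powr real n" using assms by (simp add: powr_realpow)
  then show ?thesis using assms by (simp add: powr_mult powr_powr)
qed

lemma norm_qeval_le:
  assumes "norm a \<le> K" "norm b \<le> K" "norm c \<le> K"
  shows "norm (qeval (a, b, c) z) \<le> K * (1 + norm z + norm z ^ 2)"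
proof -
  have "norm (qeval (a, b, c) z) \<le> norm a + norm (b * z) + norm (c * z\<^sup>2)"
    unfolding qeval.simps by (intro norm_triangle_le add_right_mono norm_triangle_ineq)
  also have "\<dots> = norm a + norm b * norm z + norm c * norm z ^ 2" by (simp add: norm_mult norm_power)
  also have "\<dots> \<le> K + K * norm z + K * norm z ^ 2"
    using assms by (intro add_mono mult_right_mono) auto
  finally show ?thesis by (simp add: algebra_simps)
qed

context integer_cubic
begin

lemma size_const_ge: "size_const \<ge> 3"
  unfolding size_const_def by linarith

text \<open>\<open>family_member\<close> is applied to each pair with \<open>M = 4 T\<close>.
  Injectivity holds because the middle coefficient of \<open>G q\<close> records \<open>n\<close>
  and \<open>b' q\<close>.\<close>

lemma family_exists:
  assumes par: "even (a2\<^sup>2 - a1)" "odd (a1 * a2 - a0)" and T: "T \<ge> 2"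
  shows "\<exists>G X. inj_on G (odd_coprime_pairs T) \<and> (\<forall>q\<in>odd_coprime_pairs T.
      G q \<in> gauss_quads \<and> represents (G q) (X q) \<and>
      \<bar>X q\<bar> \<le> 9 * size_const\<^sup>2 * (4 * int T) ^ 6 \<and>
      (\<forall>z. norm (qeval (G q) z) \<le> 4 * of_int (size_const * (4 * int T) ^ 3) * (1 + norm z + norm z ^ 2) \<and>
        norm (qeval (qconj (G q)) z) \<le> 4 * of_int (size_const * (4 * int T) ^ 3) * (1 + norm z + norm z ^ 2)))"
proof -
  define M where "M = 4 * int T"
  define K where "K = 4 * real_of_int (size_const * M ^ 3)"
  \<comment> \<open>Adding the odd \<open>n\<close> preserves coprimality and flips the parity of
    \<open>j\<close>. The result exceeds \<open>n\<close> exactly for even \<open>j\<close>, so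
    \<open>j\<close> can be recovered.\<close>
  define b' where "b' = (\<lambda>(n, j). if odd j then j else j + n :: nat)"
  define good where "good = (\<lambda>q g x. g \<in> gauss_quads \<and> represents g x \<and>
      fst (snd g) = Complex (of_nat (fst q)) (of_nat (b' q)) \<and>
      norm (fst g) \<le> K \<and> norm (snd (snd g)) \<le> K \<and> norm (fst (snd g)) \<le> K \<and>
      \<bar>x\<bar> \<le> 9 * size_const\<^sup>2 * M ^ 6)"
  have pairs: "odd (fst q)" "odd (b' q)" "coprime (fst q) (b' q)" "1 \<le> fst q" "fst q \<le> 2 * T"
    "1 \<le> b' q" "b' q \<le> 4 * T"
    if "q \<in> odd_coprime_pairs T" for q
  proof -
    obtain n j where q: "q = (n, j)" by (cases q)
    have n: "odd n" "T < n" "n \<le> 2 * T" "0 < j" "j \<le> n" "coprime j n"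
      using that by (auto simp: q odd_coprime_pairs_def totatives_def)
    have "coprime (j + n) n" using n(6) by (metis coprime_add_one_left coprime_iff_gcd_eq_1 gcd_add1)
    then show "odd (fst q)" "odd (b' q)" "coprime (fst q) (b' q)" "1 \<le> fst q" "fst q \<le> 2 * T"
      "1 \<le> b' q" "b' q \<le> 4 * T"
      using n by (auto simp: q b'_def coprime_commute)
  qed
  have M1: "1 \<le> M" using T by (simp add: M_def)
  have MK: "2 * real_of_int M \<le> K"
  proof -
    have "M * 1 \<le> M * M\<^sup>2" using M1 by (intro mult_left_mono) auto
    then have "M \<le> M ^ 3" by (simp add: power2_eq_square power3_eq_cube)
    also have "\<dots> \<le> size_const * M ^ 3"
      using size_const_ge M1 mult_right_mono[of 1 size_const "M ^ 3"] by simp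
    finally have "2 * M \<le> 4 * (size_const * M ^ 3)" using M1 by linarith
    then have "real_of_int (2 * M) \<le> real_of_int (4 * (size_const * M ^ 3))" by (simp only: of_int_le_iff)
    then show ?thesis by (simp add: K_def)
  qed
  have "\<exists>g x. good q g x" if q: "q \<in> odd_coprime_pairs T" for q
  proof -
    note pq = pairs[OF q]
    let ?b = "int (fst q)" and ?b' = "int (b' q)"
    have bM: "1 \<le> ?b" "?b \<le> M" "1 \<le> ?b'" "?b' \<le> M" using pq by (auto simp: M_def)
    obtain a c x where acx: "(a, Complex (of_int ?b) (of_int ?b'), c) \<in> gauss_quads"
      "represents (a, Complex (of_int ?b) (of_int ?b'), c) x"
      "norm a \<le> 4 * of_int (size_const * M ^ 3)" "norm c \<le> 2 * of_int M"
      "\<bar>x\<bar> \<le> 9 * size_const\<^sup>2 * M ^ 6"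
      using family_member[OF par, of ?b ?b' M] pq bM by auto
    have "norm (Complex (of_int ?b) (of_int ?b')) \<le> of_int M + of_int M"
      using cmod_le[of "Complex (of_int ?b) (of_int ?b')"] bM by simp
    then have "good q (a, Complex (of_int ?b) (of_int ?b'), c) x"
      using acx MK unfolding good_def by (simp add: K_def)
    then show ?thesis by blast
  qed
  then obtain G X where GX: "\<And>q. q \<in> odd_coprime_pairs T \<Longrightarrow> good q (G q) (X q)" by metis
  show ?thesis
  proof (intro exI[of _ G] exI[of _ X] conjI ballI allI)
    show "inj_on G (odd_coprime_pairs T)"
    proof (rule inj_onI)
      fix q q' assume q: "q \<in> odd_coprime_pairs T" "q' \<in> odd_coprime_pairs T" "G q = G q'"
      obtain n j n' j' where nj: "q = (n, j)" "q' = (n', j')" by (metis prod.exhaust)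
      have "Complex (of_nat (fst q)) (of_nat (b' q)) = Complex (of_nat (fst q')) (of_nat (b' q'))"
        using GX[OF q(1)] GX[OF q(2)] q(3) unfolding good_def by metis
      then have e: "n = n'" "b' (n, j) = b' (n', j')" by (auto simp: nj)
      have "0 < j" "j \<le> n" "0 < j'" "j' \<le> n'"
        using q by (auto simp: nj odd_coprime_pairs_def totatives_def)
      then have "j = j'" using e by (auto simp: b'_def split: if_splits)
      then show "q = q'" using e nj by simp
    qed
    fix q assume q: "q \<in> odd_coprime_pairs T"
    show "G q \<in> gauss_quads" "represents (G q) (X q)" using GX[OF q] by (auto simp: good_def)
    show "\<bar>X q\<bar> \<le> 9 * size_const\<^sup>2 * (4 * int T) ^ 6" using GX[OF q] by (simp add: good_def M_def)
    fix z
    obtain a b c where g: "G q = (a, b, c)" by (metis prod_cases3)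
    have "norm a \<le> K" "norm b \<le> K" "norm c \<le> K" using GX[OF q] by (auto simp: good_def g)
    then show "norm (qeval (G q) z) \<le> 4 * of_int (size_const * (4 * int T) ^ 3) * (1 + norm z + norm z ^ 2)"
      "norm (qeval (qconj (G q)) z) \<le> 4 * of_int (size_const * (4 * int T) ^ 3) * (1 + norm z + norm z ^ 2)"
      unfolding M_def[symmetric] K_def[symmetric] g qconj.simps by (auto intro!: norm_qeval_le simp del: qeval.simps)
  qed
qed

lemma abs_value_le:
  assumes "\<bar>x\<bar> \<le> W" "1 \<le> W"
  shows "\<bar>f x\<bar> \<le> size_const * W ^ 3"
proof -
  have 2: "\<bar>x\<^sup>2\<bar> \<le> W\<^sup>2" and 3: "\<bar>x ^ 3\<bar> \<le> W ^ 3" 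
    using power_mono[OF assms(1), of 2] power_mono[OF assms(1), of 3] by (simp_all add: power_abs)
  have W: "W ^ 2 \<le> W ^ 3" "W \<le> W ^ 3" "1 \<le> W ^ 3"
    using assms power_increasing[of 2 3 W] power_increasing[of 1 3 W] by auto
  have "\<bar>f x\<bar> \<le> \<bar>x ^ 3\<bar> + \<bar>a2 * x\<^sup>2\<bar> + \<bar>a1 * x\<bar> + \<bar>a0\<bar>" by simp
  also have "\<dots> \<le> W ^ 3 + \<bar>a2\<bar> * W ^ 3 + \<bar>a1\<bar> * W ^ 3 + \<bar>a0\<bar> * W ^ 3"
  proof (intro add_mono)
    show "\<bar>a2 * x\<^sup>2\<bar> \<le> \<bar>a2\<bar> * W ^ 3" unfolding abs_mult using 2 W by (intro mult_left_mono) auto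
    show "\<bar>a1 * x\<bar> \<le> \<bar>a1\<bar> * W ^ 3" unfolding abs_mult using assms W by (intro mult_left_mono) auto
    show "\<bar>a0\<bar> \<le> \<bar>a0\<bar> * W ^ 3" using W mult_left_mono[of 1 "W ^ 3" "\<bar>a0\<bar>"] by simp
  qed (rule 3)
  also have "\<dots> = (1 + \<bar>a2\<bar> + \<bar>a1\<bar> + \<bar>a0\<bar>) * W ^ 3" by (simp add: algebra_simps)
  also have "\<dots> \<le> size_const * W ^ 3"
    unfolding size_const_def using W(3) by (intro mult_right_mono) linarith+
  finally show ?thesis .
qed

text \<open>The number of family members divided by the largest number of members sharing one
  \<open>x\<close>.\<close>

lemma many_represented:
  assumes par: "even (a2\<^sup>2 - a1)" "odd (a1 * a2 - a0)" and \<delta>: "\<delta> > (0::real)"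
  shows "\<exists>c>0. \<forall>T\<ge>2. \<exists>V. finite V \<and> c * real T powr (2 - \<delta>) \<le> real (card V) \<and>
    (\<forall>x\<in>V. \<bar>x\<bar> \<le> 9 * size_const\<^sup>2 * (4 * int T) ^ 6 \<and> (\<exists>g\<in>gauss_quads. represents g x))"
proof -
  obtain z1 z2 z3 :: complex where z:
    "z1 + z2 + z3 = - of_int a2" "z1 * z2 + z1 * z3 + z2 * z3 = of_int a1"
    "z1 * z2 * z3 = - of_int a0" and dist: "z1 \<noteq> z2" "z1 \<noteq> z3" "z2 \<noteq> z3"
    using distinct_roots_exist by blast
  \<comment> \<open>The loss is 64 times \<open>e\<close>: 1 from counting pairs, 54 from the cubed
    divisor bound for \<open>f x = O(T^18)\<close>, and 9 from three logarithms of
    \<open>Y = O(T^3)\<close>.\<close>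
  define e where "e = \<delta> / 64"
  have e: "e > 0" using \<delta> by (simp add: e_def)
  obtain C1 where C1: "C1 \<ge> 1" "\<And>n. n > 0 \<Longrightarrow> real (divisor_count n) \<le> C1 * real n powr e"
    using divisor_count_le_powr[OF e] by blast
  obtain c0 where c0: "c0 > 0"
    "\<And>T. T \<ge> 2 \<Longrightarrow> c0 * real T powr (2 - e) \<le> real (card (odd_coprime_pairs T))"
    using card_odd_coprime_pairs_ge[OF e] by blast
  define R where "R z = 1 + norm z + norm z ^ 2" for z :: complex
  define \<kappa> where "\<kappa> = R z1 + R z2 + R z3"
  define E where "E = real_of_int size_const"
  define D where "D = {d \<in> gauss_quads. \<forall>z\<in>{z1, z2, z3}. norm (qeval d z) \<le> 2}"
  \<comment> \<open>256 is \<open>4 * 4^3\<close>, from the bound in \<open>family_exists\<close>.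
    \<open>K2\<close> comes from inserting the bound on \<open>x\<close> into
    \<open>abs_value_le\<close>.\<close>
  define K1 where "K1 = 256 * E * \<kappa>"
  define K2 where "K2 = E * (9 * E\<^sup>2 * 4 ^ 6) ^ 3"
  define C2 where "C2 = 6 / (e * ln 2) + 2"
  \<comment> \<open>The added 1 ensures \<open>K3\<close> \<ge> 1, so that division by it is
    safe.\<close>
  define K3 where "K3 = 2 * (C1 * K2 powr e) ^ 3 * (C2 * K1 powr e) ^ 3 * real (card D) + 1"
  have R1: "R z \<ge> 1" for z by (simp add: R_def)
  have Rk: "R z \<le> \<kappa>" if "z \<in> {z1, z2, z3}" for z
    using that R1[of z1] R1[of z2] R1[of z3] by (auto simp: \<kappa>_def)
  have E3: "E \<ge> 3" using size_const_ge by (simp add: E_def)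
  have k1: "\<kappa> \<ge> 1" using R1[of z1] R1[of z2] R1[of z3] by (simp add: \<kappa>_def)
  have K11: "K1 \<ge> 1" unfolding K1_def using E3 k1 mult_mono[of 1 E 1 \<kappa>] by simp
  have K21: "K2 > 0" using E3 by (simp add: K2_def)
  have C20: "C2 \<ge> 0" using e by (simp add: C2_def)
  have K31: "K3 \<ge> 1" using C1 C20 by (simp add: K3_def)
  show ?thesis
  proof (intro exI[of _ "c0 / K3"] conjI allI impI)
    show "0 < c0 / K3" using c0 K31 by simp
  next
    fix T :: nat assume T: "2 \<le> T"
    define W where "W = 9 * size_const\<^sup>2 * (4 * int T) ^ 6"
    define Y where "Y = K1 * real T ^ 3"
    define Q where "Q = odd_coprime_pairs T"
    obtain G X where inj: "inj_on G Q" and GX: "\<forall>q\<in>Q. G q \<in> gauss_quads \<and> represents (G q) (X q) \<and>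
        \<bar>X q\<bar> \<le> W \<and> (\<forall>z. norm (qeval (G q) z) \<le> 4 * of_int (size_const * (4 * int T) ^ 3) * R z \<and>
          norm (qeval (qconj (G q)) z) \<le> 4 * of_int (size_const * (4 * int T) ^ 3) * R z)"
      using family_exists[OF par T, folded Q_def W_def R_def] by blast
    have G: "G q \<in> gauss_quads" "represents (G q) (X q)" "\<bar>X q\<bar> \<le> W"
      "norm (qeval (G q) z) \<le> 4 * of_int (size_const * (4 * int T) ^ 3) * R z"
      "norm (qeval (qconj (G q)) z) \<le> 4 * of_int (size_const * (4 * int T) ^ 3) * R z"
      if "q \<in> Q" for q z
      using bspec[OF GX that] by simp_all
    have finQ: "finite Q" unfolding Q_def odd_coprime_pairs_def
      by (intro finite_SigmaI finite_subset[of "{n. odd n \<and> T < n \<and> n \<le> 2 * T}" "{..2 * T}"]) auto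
    have W1: "1 \<le> W"
    proof -
      have "1 * 1 \<le> (9 * size_const\<^sup>2) * (4 * int T) ^ 6"
        using size_const_ge T by (intro mult_mono one_le_power) (auto intro: order_trans[of _ "size_const ^ 2"])
      then show ?thesis by (simp add: W_def)
    qed
    have Y1: "1 \<le> Y"
      unfolding Y_def using K11 T mult_mono[of 1 K1 1 "real T ^ 3"] by simp
    have evalY: "4 * of_int (size_const * (4 * int T) ^ 3) * R z \<le> Y" if "z \<in> {z1, z2, z3}" for z
    proof -
      have "4 * of_int (size_const * (4 * int T) ^ 3) * R z = 256 * E * real T ^ 3 * R z"
        by (simp add: E_def power_mult_distrib)
      also have "\<dots> \<le> 256 * E * real T ^ 3 * \<kappa>" using Rk[OF that] E3 by (intro mult_left_mono) auto
      finally show ?thesis by (simp add: Y_def K1_def mult_ac)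
    qed
    have fiber: "real (card {q \<in> Q. X q = x}) \<le> K3 * real T powr (63 * e)" if x: "\<bar>x\<bar> \<le> W" for x
    proof -
      define S where "S = {g \<in> gauss_quads. represents g x \<and>
        (\<forall>z\<in>{z1, z2, z3}. norm (qeval g z) \<le> Y \<and> norm (qeval (qconj g) z) \<le> Y)}"
      note S = card_representations_le[OF z dist Y1, of x, folded S_def D_def]
      have "G ` {q \<in> Q. X q = x} \<subseteq> S"
      proof
        fix g assume "g \<in> G ` {q \<in> Q. X q = x}"
        then obtain q where q: "q \<in> Q" "X q = x" "g = G q" by blast
        show "g \<in> S" unfolding S_def q(3)
          using G(1,2)[OF q(1)] q(2) order_trans[OF G(4)[OF q(1)] evalY]
            order_trans[OF G(5)[OF q(1)] evalY] by blast
      qed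
      moreover have "inj_on G {q \<in> Q. X q = x}" using inj by (rule inj_on_subset) auto
      ultimately have "card {q \<in> Q. X q = x} \<le> card S" using S(1) by (intro card_inj_on_le)
      then have "real (card {q \<in> Q. X q = x}) \<le> real (card S)" by simp
      also have "\<dots> \<le> 2 * real (divisor_count (nat \<bar>f x\<bar>)) ^ 3 * (6 * log 2 Y + 2) ^ 3 * real (card D)"
        by (rule S(2))
      also have "\<dots> \<le> 2 * (C1 * K2 powr e * real T powr (18 * e)) ^ 3
          * (C2 * K1 powr e * real T powr (3 * e)) ^ 3 * real (card D)"
      proof (intro mult_right_mono mult_mono mult_left_mono power_mono)
        have "real (nat \<bar>f x\<bar>) = of_int \<bar>f x\<bar>" by simp
        also have "\<dots> \<le> of_int (size_const * W ^ 3)"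
          using abs_value_le[OF x W1] by (simp only: of_int_le_iff)
        also have "\<dots> = K2 * real T ^ 18" by (simp add: W_def K2_def E_def power_mult_distrib)
        finally have "real (nat \<bar>f x\<bar>) powr e \<le> (K2 * real T ^ 18) powr e"
          using e by (intro powr_mono2) auto
        also have "\<dots> = K2 powr e * real T powr (18 * e)"
          using K21 T by (simp add: powr_mult_power)
        finally have "C1 * real (nat \<bar>f x\<bar>) powr e \<le> C1 * (K2 powr e * real T powr (18 * e))"
          using C1 by (intro mult_left_mono) auto
        moreover have "nat \<bar>f x\<bar> > 0" using no_integer_root[of x] by simp
        ultimately show "real (divisor_count (nat \<bar>f x\<bar>)) \<le> C1 * K2 powr e * real T powr (18 * e)"
          using C1(2)[of "nat \<bar>f x\<bar>"] by (simp add: mult.assoc)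
      next
        \<comment> \<open>The logarithm is absorbed into the power \<open>Y powr e\<close>.\<close>
        have "log 2 Y \<le> Y powr e / (e * ln 2)"
          using ln_powr_bound[OF Y1 e] by (simp add: log_def field_simps)
        moreover have "1 \<le> Y powr e" using Y1 e by (simp add: ge_one_powr_ge_zero)
        ultimately have "6 * log 2 Y + 2 \<le> 6 * (Y powr e / (e * ln 2)) + 2 * Y powr e" by linarith
        also have "\<dots> = C2 * Y powr e" by (simp add: C2_def algebra_simps)
        also have "Y powr e = K1 powr e * real T powr (3 * e)"
          using K11 T by (simp add: Y_def powr_mult_power)
        finally show "6 * log 2 Y + 2 \<le> C2 * K1 powr e * real T powr (3 * e)" by (simp add: mult.assoc)
      qed (use Y1 C1 in auto)
      also have "\<dots> = (K3 - 1) * ((real T powr (18 * e)) ^ 3 * (real T powr (3 * e)) ^ 3)"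
        by (simp add: K3_def power_mult_distrib)
      also have "(real T powr (18 * e)) ^ 3 * (real T powr (3 * e)) ^ 3 = real T powr (63 * e)"
        using T by (simp add: powr_powr flip: powr_realpow powr_add)
      also have "(K3 - 1) * real T powr (63 * e) \<le> K3 * real T powr (63 * e)"
        by (intro mult_right_mono) auto
      finally show ?thesis .
    qed
    show "\<exists>V. finite V \<and> c0 / K3 * real T powr (2 - \<delta>) \<le> real (card V) \<and>
      (\<forall>x\<in>V. \<bar>x\<bar> \<le> 9 * size_const\<^sup>2 * (4 * int T) ^ 6 \<and> (\<exists>g\<in>gauss_quads. represents g x))"
    proof (intro exI[of _ "X ` Q"] conjI ballI)
      show "finite (X ` Q)" using finQ by simp
      define m where "m = nat \<lfloor>K3 * real T powr (63 * e)\<rfloor>"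
      have m: "real m \<le> K3 * real T powr (63 * e)" using K31 by (simp add: m_def)
      have "card Q \<le> card (X ` Q) * m"
      proof (rule card_le_card_image_mult[OF finQ])
        fix y assume "y \<in> X ` Q"
        then have "\<bar>y\<bar> \<le> W" using G(3) by auto
        from fiber[OF this] show "card {q \<in> Q. X q = y} \<le> m" unfolding m_def by linarith
      qed
      then have "real (card Q) \<le> real (card (X ` Q)) * real m" by (simp flip: of_nat_mult)
      also have "\<dots> \<le> real (card (X ` Q)) * (K3 * real T powr (63 * e))"
        using m by (intro mult_left_mono) auto
      finally have "c0 * real T powr (2 - e) \<le> real (card (X ` Q)) * (K3 * real T powr (63 * e))"
        using c0(2)[OF T] by (simp add: Q_def)
      also have "real T powr (2 - e) = real T powr (2 - \<delta>) * real T powr (63 * e)"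
        by (simp add: e_def flip: powr_add)
      finally have "(c0 * real T powr (2 - \<delta>)) * real T powr (63 * e)
          \<le> (real (card (X ` Q)) * K3) * real T powr (63 * e)" by (simp add: mult_ac)
      then have "c0 * real T powr (2 - \<delta>) \<le> real (card (X ` Q)) * K3" using T by simp
      then show "c0 / K3 * real T powr (2 - \<delta>) \<le> real (card (X ` Q))"
        using K31 by (simp add: field_simps)
    next
      fix x assume "x \<in> X ` Q"
      then obtain q where q: "q \<in> Q" "x = X q" by blast
      show "\<bar>x\<bar> \<le> 9 * size_const\<^sup>2 * (4 * int T) ^ 6" using G(3)[OF q(1)] by (simp add: q(2) W_def)
      show "\<exists>g\<in>gauss_quads. represents g x" using G(1,2)[OF q(1)] q(2) by blast
    qed
  qed
qed

end

text \<open>The represented integers are \<open>O(T^6)\<close> in size, so \<open>T\<close> is taken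
  near \<open>(X / K) powr (1 / 6)\<close>. Then \<open>T powr (2 - 6 * \<eta>)\<close> has order
  \<open>X powr (1 / 3 - \<eta>)\<close>, and the boundedly many nonpositive integers are
  discarded.\<close>

theorem theorem1p1:
  fixes a0 a1 a2 :: int and p :: "int poly"
  assumes p_def: "p = [:a0, a1, a2, 1:]"
    and irred: "irreducible p"
    and par1: "even (a2\<^sup>2 - a1)"
    and par2: "odd (a1 * a2 - a0)"
  shows "\<forall>\<epsilon>>0. \<exists>C>0. \<exists>X0\<ge>1. \<forall>X\<ge>X0.
           real (card (B p X)) \<ge> C * X powr (1 / 3 - \<epsilon>)"
proof (intro allI impI)
  fix \<epsilon> :: real assume \<epsilon>: "\<epsilon> > 0"
  interpret integer_cubic a0 a1 a2 using irred by unfold_locales (simp add: p_def)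
  \<comment> \<open>Capping at 1/6 keeps the exponent \<open>s\<close> positive. Larger \<epsilon>
    follow by monotonicity, as \<open>X\<close> \<ge> 1.\<close>
  define \<eta> where "\<eta> = min \<epsilon> (1 / 6)"
  have \<eta>: "0 < \<eta>" "\<eta> \<le> \<epsilon>" "\<eta> \<le> 1 / 6" using \<epsilon> by (auto simp: \<eta>_def)
  obtain c where c: "c > 0" "\<And>T. T \<ge> 2 \<Longrightarrow> \<exists>V. finite V \<and> c * real T powr (2 - 6 * \<eta>) \<le> real (card V) \<and>
    (\<forall>x\<in>V. \<bar>x\<bar> \<le> 9 * size_const\<^sup>2 * (4 * int T) ^ 6 \<and> (\<exists>g\<in>gauss_quads. represents g x))"
    using many_represented[OF par1 par2, of "6 * \<eta>"] \<eta> by auto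
  define s where "s = 1 / 3 - \<eta>"
  have s: "s \<ge> 1 / 6" using \<eta> by (simp add: s_def)
  define R where "R = 1 + \<bar>a0\<bar> + \<bar>a1\<bar> + \<bar>a2\<bar>"
  define K where "K = real_of_int (9 * size_const\<^sup>2 * 4 ^ 6)"
  \<comment> \<open>The factor \<open>2 powr (6 * s)\<close> pays for rounding \<open>t\<close> down
    to \<open>T\<close> \<ge> \<open>t / 2\<close>.\<close>
  define c' where "c' = c / (2 powr (6 * s) * K powr s)"
  \<comment> \<open>The bound \<open>2 ^ 6 * K\<close> gives \<open>t\<close> \<ge> 2. The last one
    makes \<open>R\<close> at most half of the main term \<open>c' * X powr s\<close>.\<close>
  define X0 where "X0 = max (max 1 (2 ^ 6 * K)) ((2 * real_of_int R / c') powr (1 / s))"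
  have K0: "K > 0" using size_const_ge by (simp add: K_def)
  have c'0: "c' > 0" using c K0 by (simp add: c'_def)
  have polyp: "poly p x = f x" for x
    by (simp add: p_def algebra_simps power2_eq_square power3_eq_cube)
  have main: "c' / 2 * X powr (1 / 3 - \<epsilon>) \<le> real (card (B p X))" if X: "X0 \<le> X" for X
  proof -
    from X have X1: "1 \<le> X" "2 ^ 6 * K \<le> X" "(2 * real_of_int R / c') powr (1 / s) \<le> X"
      by (auto simp: X0_def)
    define t where "t = (X / K) powr (1 / 6)"
    have t6: "t ^ 6 = X / K" using X1 K0 by (simp add: t_def powr_powr flip: powr_realpow)
    have t2: "t \<ge> 2"
    proof -
      have "2 ^ 6 \<le> t ^ 6" using X1 K0 by (simp add: t6 field_simps)
      then show ?thesis using power_mono_iff[of 2 t 6] by (simp add: t_def)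
    qed
    define T where "T = nat \<lfloor>t\<rfloor>"
    have T: "2 \<le> T" "real T \<le> t" "t / 2 \<le> real T" using t2 unfolding T_def by linarith+
    obtain V where V: "finite V" "c * real T powr (2 - 6 * \<eta>) \<le> real (card V)"
      "\<And>x. x \<in> V \<Longrightarrow> \<bar>x\<bar> \<le> 9 * size_const\<^sup>2 * (4 * int T) ^ 6"
      "\<And>x. x \<in> V \<Longrightarrow> \<exists>g\<in>gauss_quads. represents g x"
      using c(2)[OF T(1)] by blast
    have finB: "finite (B p X)"
      by (rule finite_subset[of _ "{1..\<lfloor>X\<rfloor>}"]) (auto simp: B_def le_floor_iff)
    have sub: "V \<subseteq> B p X \<union> {- R<..0}"
    proof
      fix x assume x: "x \<in> V"
      obtain g where g: "g \<in> gauss_quads" "represents g x" using V(4)[OF x] by blast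
      have "real_of_int x \<le> of_int (9 * size_const\<^sup>2 * (4 * int T) ^ 6)"
        using V(3)[OF x] by (intro of_int_le_iff[THEN iffD2]) linarith
      also have "\<dots> = K * real T ^ 6" by (simp add: K_def power_mult_distrib)
      also have "\<dots> \<le> K * t ^ 6" using T K0 by (intro mult_left_mono power_mono) auto
      also have "\<dots> = X" using K0 by (simp add: t6)
      finally have "real_of_int x \<le> X" .
      moreover have "x > - R" using represents_lower_bound[OF g] by (simp add: R_def)
      moreover have "sum_of_two_squares (poly p x)"
        unfolding polyp by (rule represents_sum_of_two_squares[OF g])
      ultimately show "x \<in> B p X \<union> {- R<..0}" by (auto simp: B_def)
    qed
    \<comment> \<open>The second set has \<open>R\<close> elements, a loss independent of
      \<open>X\<close>.\<close>
    have "card V \<le> card (B p X) + card {- R<..0}"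
      using card_mono[OF _ sub] card_Un_le[of "B p X" "{- R<..0}"] finB by simp
    then have "real (card V) \<le> real (card (B p X)) + of_int R"
      by (simp add: R_def flip: of_nat_add)
    moreover have "c' * X powr s \<le> real (card V)"
    proof -
      have "X powr s = (K * t ^ 6) powr s" using K0 by (simp add: t6)
      also have "\<dots> = K powr s * t powr (6 * s)"
        using K0 t2 by (simp add: powr_mult_power)
      finally have "c' * X powr s = c * (t / 2) powr (6 * s)"
        using t2 K0 by (simp add: c'_def powr_divide)
      also have "\<dots> \<le> c * real T powr (6 * s)"
        using T t2 c s by (intro mult_left_mono powr_mono2) auto
      also have "6 * s = 2 - 6 * \<eta>" by (simp add: s_def)
      finally show ?thesis using V(2) by simp
    qed
    moreover have "of_int R \<le> c' / 2 * X powr s"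
    proof -
      have "2 * real_of_int R / c' = ((2 * real_of_int R / c') powr (1 / s)) powr s"
        using s c'0 by (simp add: powr_powr R_def)
      also have "\<dots> \<le> X powr s" using X1 s by (intro powr_mono2) auto
      finally show ?thesis using c'0 by (simp add: field_simps)
    qed
    ultimately have "c' / 2 * X powr s \<le> real (card (B p X))" by linarith
    moreover have "c' / 2 * X powr (1 / 3 - \<epsilon>) \<le> c' / 2 * X powr s"
      using c'0 X1 \<eta> by (intro mult_left_mono powr_mono) (auto simp: s_def)
    ultimately show ?thesis by linarith
  qed
  have "c' / 2 > 0" "X0 \<ge> 1" using c'0 by (auto simp: X0_def)
  with main show "\<exists>C>0. \<exists>X0\<ge>1. \<forall>X\<ge>X0. C * X powr (1 / 3 - \<epsilon>) \<le> real (card (B p X))"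
    by blast
qed

end
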